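(* Let $M$ be an integer and let $f\in L^2(\mathbb{D},\mathrm{d}A)$ have the form $f(r\mathrm{e}^{\mathrm{i}\theta})=\sum_{m=-\infty}^{M} f_m(r)\mathrm{e}^{\mathrm{i}m\theta}$ for $z=r\mathrm{e}^{\mathrm{i}\theta}\in\mathbb{D}$ (that is, the angular Fourier coefficients $f_m$ of $f$ vanish for all $m>M$). Assume that there is a positive integer $N$ such that $\int_0^1 f_M(r)r^k\,\mathrm{d}r\neq 0$ for all integers $k\geq N$. If $g\in L^2(\mathbb{D},\mathrm{d}A)$ is such that the (densely defined) operator $T_gT_f$ on $A^2$ has finite rank, then $g$ is the zero function, i.e. $g=0$ almost everywhere on $\mathbb{D}$.
   Context: $\mathbb{D}$ is the open unit disk in $\mathbb{C}$ and $\mathrm{d}A=\frac1\pi\mathrm{d}x\,\mathrm{d}y$ is normalized Lebesgue measure on $\mathbb{D}$. $A^2$ is the Bergman space, the closed subspace of holomorphic functions in $L^2=L^2(\mathbb{D},\mathrm{d}A)$, and $P:L^2\to A^2$ is the orthogonal projection. $H^\infty$ is the space of bounded holomorphic functions on $\mathbb{D}$. For $f\in L^2$, the Toeplitz operator $T_f$ is densely defined on $A^2$ by $T_f\varphi=P(f\varphi)$ for $\varphi\in H^\infty$. Every $f\in L^2$ has an expansion $f(r\mathrm{e}^{\mathrm{i}\theta})=\sum_{m=-\infty}^{\infty}f_m(r)\mathrm{e}^{\mathrm{i}m\theta}$ converging in $L^2(\mathbb{D})$, where $f_m(r)=\frac{1}{2\pi}\int_0^{2\pi}f(r\mathrm{e}^{\mathrm{i}\theta})\mathrm{e}^{-\mathrm{i}m\theta}\,\mathrm{d}\theta$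 for almost every $r\in[0,1)$, and $\int_0^1|f_m(r)|^2r\,\mathrm{d}r<\infty$. For $f$ as in the claim, $T_f$ maps the space $\mathcal{P}$ of polynomials in $z$ into $\mathcal{P}$, so $T_gT_f$ is defined on $\mathcal{P}$, which is dense in $A^2$; "$T_gT_f$ has finite rank" means that $T_gT_f(\mathcal{P})$ is finite-dimensional. *)

theory Defs
  imports
    "HOL-Complex_Analysis.Complex_Analysis"
    "HOL-Computational_Algebra.Polynomial"
    "HOL-Library.Function_Algebras"
begin

definition disk_measure :: "complex measure" where
  "disk_measure = density (lebesgue_on (ball 0 1)) (\<lambda>_. ennreal (1 / pi))"

text \<open>Elements of L2 are represented by functions; two functions that agree almost everywhere with
  respect to \<^const>\<open>disk_measure\<close> stand for the same element.
  Values outside the disk are irrelevant.\<close>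

definition L2_disk :: "(complex \<Rightarrow> complex) set" where
  "L2_disk = {f. f \<in> borel_measurable disk_measure \<and>
                 integrable disk_measure (\<lambda>z. (cmod (f z))\<^sup>2)}"

definition L2_inner :: "(complex \<Rightarrow> complex) \<Rightarrow> (complex \<Rightarrow> complex) \<Rightarrow> complex" where
  "L2_inner u v = (LINT z|disk_measure. u z * cnj (v z))"

text \<open>A class in the Bergman space has exactly one representative that is holomorphic on the disk and
  zero off the disk; the latter condition makes equality in the Bergman space the
  equality of HOL functions.\<close>

definition bergman_space :: "(complex \<Rightarrow> complex) set" where
  "bergman_space = {u \<in> L2_disk. u holomorphic_on ball 0 1 \<and> (\<forall>z. z \<notin> ball 0 1 \<longrightarrow> u z = 0)}"

text \<open>The orthogonal projection of L2 onto the Bergman space. As that space is closed in L2, the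
  description has a unique solution for every \<open>h \<in> L2_disk\<close>;
  for other \<open>h\<close> the value is meaningless.\<close>

definition bergman_proj :: "(complex \<Rightarrow> complex) \<Rightarrow> (complex \<Rightarrow> complex)" where
  "bergman_proj h =
    (THE u. u \<in> bergman_space \<and> (\<forall>v\<in>bergman_space. L2_inner (\<lambda>z. h z - u z) v = 0))"

text \<open>Meaningful for \<open>f \<in> L2_disk\<close> and \<open>\<phi>\<close> bounded and holomorphic on the disk, where
  the product lies in L2. The result depends only on the values of \<open>\<phi>\<close> in the disk.\<close>

definition toeplitz :: "(complex \<Rightarrow> complex) \<Rightarrow> (complex \<Rightarrow> complex) \<Rightarrow> (complex \<Rightarrow> complex)" where
  "toeplitz f \<phi> = bergman_proj (\<lambda>z. f z * \<phi> z)"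

definition angular_coeff :: "(complex \<Rightarrow> complex) \<Rightarrow> int \<Rightarrow> real \<Rightarrow> complex" where
  "angular_coeff f m r =
    1 / (2 * pi) * (LINT t|lebesgue_on {0..2*pi}. f (rcis r t) * exp (- \<i> * of_int m * of_real t))"

global_interpretation cfun: vector_space "\<lambda>(c::complex) (u::complex \<Rightarrow> complex) z. c * u z"
  by unfold_locales (auto simp: fun_eq_iff algebra_simps)

definition finite_dimensional :: "(complex \<Rightarrow> complex) set \<Rightarrow> bool" where
  "finite_dimensional S \<longleftrightarrow> (\<exists>B. finite B \<and> S \<subseteq> cfun.span B)"

text \<open>Finite rank of an operator whose domain is the space of polynomial functions.\<close>

definition finite_rank_on_polys :: "((complex \<Rightarrow> complex) \<Rightarrow> (complex \<Rightarrow> complex)) \<Rightarrow> bool" where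
  "finite_rank_on_polys T \<longleftrightarrow> finite_dimensional (T ` range (poly :: complex poly \<Rightarrow> _))"

end

theory Submission
  imports Defs "Jordan_Normal_Form.Determinant"
begin

text \<open>
  The operator $T_f$ maps $z^n$ to a polynomial of degree at most $n + M$ whose coefficient at
  $z^{n+M}$ is a nonzero multiple of $\int_0^1 f_M(r) r^{2n+M+1}\,dr$. For large $n$ the degree is therefore
  exactly $n + M$, so $T_f(\mathcal P)$ together with finitely many monomials spans $\mathcal P$, and
  $T_g$ itself has finite rank on $\mathcal P$.

  It remains to show that a finite rank Toeplitz operator with symbol in $L^2$ vanishes
  (D. Luecking's argument). If the rank is less than $N$, then
  $\det(\int z^i \bar z^j\, s \bar t\, g\,dA)_{i,j<N} = 0$ for all polynomials $s, t$. By Andreief's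
  identity this says that $\int \prod_i s(z_i)\overline{t(z_i)}\, |V(z)|^2 \prod_i g(z_i)\,dA^N = 0$, where
  $V$ is the Vandermonde determinant. The functions $\prod_i s(z_i)\overline{t(z_i)}$ span a self-adjoint
  algebra that separates unordered tuples, so by Stone--Weierstrass, on the quotient of the
  polydisk by permutations of the coordinates, $s\bar t$ may be replaced by any continuous $h$ and
  in the limit by $\overline{\mathrm{sgn}\, g}$. The resulting Gram matrix of $|g|\,dA$ is singular only
  if $g = 0$ almost everywhere.
\<close>

text \<open>The obstacle is that a determinant is not linear in its weight: vanishing for every
  weight s conj(t) says nothing directly about sums of such weights, although it is these sums that
  are uniformly dense among the continuous functions on the closed disk. Andreief's identity removes
  it, since on N-tuples the determinant becomes an integral that is linear in the function of the
  tuple. The price is that the available functions are all invariant under permutation of the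
  coordinates, so density can hold only among invariant functions; the target, the product of the
  values h(z_i), is one of them. The factors s and t are available because one bound on the rank
  serves them all: for every s the N functions T_g(s z^i) are dependent, and orthogonality to all
  polynomials includes orthogonality to t z^j. As sgn g is only measurable, it is reached by two
  different limits: uniform approximation of a continuous h on the polydisk, then dominated
  convergence in the single integrals that form the matrix. The weight conj(sgn g) turns g into |g|,
  for which the vanishing of a quadratic form is conclusive.\<close>

no_notation fps_nth (infixl \<open>$\<close> 75)
no_notation vec_index (infixl \<open>$\<close> 100)
no_notation scalar_prod (infix \<open>\<bullet>\<close> 70)

section \<open>Polar coordinates\<close>

text \<open>The change of variables formula with a Jacobian determinant lives on
  \<open>real^2\<close>, Fubini's theorem on pairs; this identification of the two Lebesgue measures
  connects them.\<close>

lemma lborel_vec2_pair: "(lborel :: (real \<times> real) measure) = distr (lborel :: (real^2) measure) borel (\<lambda>v. (v $ 1, v $ 2))"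
proof (rule lborel_eqI)
  fix l u :: "real \<times> real"
  assume le: "\<And>b. b \<in> Basis \<Longrightarrow> l \<bullet> b \<le> u \<bullet> b"
  have le': "fst l \<le> fst u" "snd l \<le> snd u"
    using le[of "(1,0)"] le[of "(0,1)"] by (auto simp: Basis_prod_def inner_prod_def)
  have m: "(\<lambda>v::real^2. (v $ 1, v $ 2)) \<in> borel_measurable lborel"
    by (subst measurable_lborel2, intro borel_measurable_continuous_onI continuous_intros)
  have eq: "(\<lambda>v::real^2. (v $ 1, v $ 2)) -` box l u = box (vector [fst l, snd l]) (vector [fst u, snd u])"
    by (auto simp: mem_box_cart forall_2 mem_box Basis_prod_def inner_prod_def)
  show "emeasure (distr (lborel :: (real^2) measure) borel (\<lambda>v. (v $ 1, v $ 2))) (box l u) = (\<Prod>b\<in>Basis. (u - l) \<bullet> b)"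
    apply (subst emeasure_distr[OF m])
    using le'
    by (auto simp: eq emeasure_lborel_box_eq Basis_vec_def Basis_prod_def inner_prod_def UNIV_2 axis_eq_axis inner_axis prod.union_disjoint)
qed simp

text \<open>The polar map is injective on the strip \<open>S\<close> with Jacobian determinant r,
  and its image misses only points of the real axis, a null set. Hence r integrates over the
  preimage of a box to the area of the box.\<close>

lemma emeasure_polar_vec2_box:
  fixes l u :: complex
  assumes le: "Re l \<le> Re u" "Im l \<le> Im u"
  defines "S \<equiv> {v :: real^2. 0 < v $ 1 \<and> 0 < v $ 2 \<and> v $ 2 < 2 * pi}"
  shows "(\<integral>\<^sup>+ v. indicator {v \<in> S. rcis (v $ 1) (v $ 2) \<in> box l u} v * ennreal (v $ 1) \<partial>lborel) =
    ennreal ((Re u - Re l) * (Im u - Im l))"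
proof -
  define g :: "real^2 \<Rightarrow> real^2" where "g v = vector [v $ 1 * cos (v $ 2), v $ 1 * sin (v $ 2)]" for v
  define g' :: "real^2 \<Rightarrow> real^2 \<Rightarrow> real^2"
    where "g' v h = vector [cos (v $ 2) * h $ 1 - v $ 1 * sin (v $ 2) * h $ 2,
                            sin (v $ 2) * h $ 1 + v $ 1 * cos (v $ 2) * h $ 2]" for v h
  define T where "T = {v \<in> S. rcis (v $ 1) (v $ 2) \<in> box l u}"
  define B :: "(real^2) set" where "B = box (vector [Re l, Im l]) (vector [Re u, Im u])"
  have meas_T: "T \<in> sets lebesgue"
  proof -
    have "open T"
      unfolding T_def S_def rcis_def cis.code Complex_eq mem_box Basis_complex_def
      by (simp, intro open_Collect_conj open_Collect_less continuous_intros)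
    then show ?thesis by (simp add: borel_open)
  qed
  \<comment> \<open>As a combination of fixed unit vectors the map is accessible to the
    differentiation rules.\<close>
  have g_eq: "g = (\<lambda>v. (v $ 1 * cos (v $ 2)) *\<^sub>R axis 1 1 + (v $ 1 * sin (v $ 2)) *\<^sub>R axis 2 1)"
    by (auto simp: g_def fun_eq_iff Finite_Cartesian_Product.vec_eq_iff forall_2 axis_def)
  have der: "(g has_derivative g' v) (at v within T)" for v
  proof -
    have nth: "((\<lambda>x. x $ i) has_derivative (\<lambda>h. h $ i)) (at v within T)" for i :: 2
      by (rule bounded_linear_imp_has_derivative[OF bounded_linear_vec_nth])
    show ?thesis
      unfolding g_eq
      by (rule has_derivative_eq_rhs, (rule derivative_intros nth)+)
         (auto simp: g'_def fun_eq_iff Finite_Cartesian_Product.vec_eq_iff forall_2 axis_def algebra_simps)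
  qed
  have inj: "inj_on g T"
  proof (rule inj_onI)
    fix v w assume vw: "v \<in> T" "w \<in> T" "g v = g w"
    then have eq: "rcis (v $ 1) (v $ 2) = rcis (w $ 1) (w $ 2)"
      by (simp add: g_def Finite_Cartesian_Product.vec_eq_iff forall_2 complex_eq_iff)
    then have r: "v $ 1 = w $ 1"
    proof -
      have "\<bar>v $ 1\<bar> = \<bar>w $ 1\<bar>"
        by (metis eq complex_mod_rcis)
      with vw(1,2) show ?thesis by (auto simp: T_def S_def)
    qed
    then have "cis (v $ 2) = cis (w $ 2)"
      using eq vw(1) by (simp add: rcis_def T_def S_def r)
    moreover have "Arg2pi (cis (x $ 2)) = x $ 2" if "x \<in> T" for x :: "real^2"
      using that by (intro Arg2pi_unique[of 1]) (auto simp: T_def S_def cis_conv_exp)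
    ultimately have "v $ 2 = w $ 2"
      using vw(1,2) by metis
    with r show "v = w" by (simp add: Finite_Cartesian_Product.vec_eq_iff forall_2)
  qed
  have det: "\<bar>Determinants.det (matrix (g' v))\<bar> = v $ 1" if "v \<in> T" for v
  proof -
    have "Determinants.det (matrix (g' v)) = v $ 1 * ((cos (v $ 2))\<^sup>2 + (sin (v $ 2))\<^sup>2)"
      by (simp add: det_2 matrix_def g'_def axis_def power2_eq_square algebra_simps del: sin_cos_squared_add sin_cos_squared_add2 sin_cos_squared_add3)
    then show ?thesis using that by (simp add: T_def S_def)
  qed
  have image: "g ` T \<subseteq> B" "B - {w. axis 2 1 \<bullet> w = 0} \<subseteq> g ` T"
  proof -
    show "g ` T \<subseteq> B"
      by (auto simp: T_def g_def B_def mem_box_cart forall_2 mem_box Basis_complex_def)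
    \<comment> \<open>Only the nonnegative half of the real axis is missed, but the whole axis is a
      hyperplane and therefore visibly negligible.\<close>
    show "B - {w. axis 2 1 \<bullet> w = 0} \<subseteq> g ` T"
    proof
      fix w assume w: "w \<in> B - {w. axis 2 1 \<bullet> w = 0}"
      define z where "z = Complex (w $ 1) (w $ 2)"
      define v :: "real^2" where "v = vector [cmod z, Arg2pi z]"
      have im: "Im z \<noteq> 0" using w by (simp add: z_def inner_axis')
      have z: "z = rcis (cmod z) (Arg2pi z)"
        using Arg2pi_eq[of z] by (simp add: rcis_def cis_conv_exp)
      have "Arg2pi z \<noteq> 0" using im Arg2pi_eq_0[of z] by (auto simp: complex_is_Real_iff)
      then have "v \<in> S" using Arg2pi[of z] im by (auto simp: S_def v_def)
      moreover have "z \<in> box l u" using w by (simp add: z_def B_def mem_box_cart forall_2 mem_box Basis_complex_def)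
      ultimately have "v \<in> T" using z by (simp add: T_def v_def)
      moreover have "g v = w"
      proof -
        have "Re z = cmod z * cos (Arg2pi z)" "Im z = cmod z * sin (Arg2pi z)"
          by (subst z, simp only: Re_rcis Im_rcis)+
        then show ?thesis by (simp add: g_def v_def Finite_Cartesian_Product.vec_eq_iff forall_2 z_def)
      qed
      ultimately show "w \<in> g ` T" by blast
    qed
  qed
  have negl: "negligible (B - g ` T)" "negligible (g ` T - B)"
    using image by (auto intro: negligible_subset[OF negligible_hyperplane[of "axis 2 1" 0]] simp: Diff_eq_empty_iff[THEN iffD2])
  have "g ` T \<in> lmeasurable \<and> measure lebesgue (g ` T) = measure lebesgue B"
    using measure_negligible_symdiff[of B "g ` T"] lmeasurable_negligible_symdiff[of B "g ` T"] negl
    by (auto simp: B_def)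
  then have "((\<lambda>v. \<bar>Determinants.det (matrix (g' v))\<bar>) has_integral measure lebesgue B) T"
    using has_measure_differentiable_image[OF meas_T der inj] by blast
  then have "((\<lambda>v. v $ 1) has_integral measure lebesgue B) T"
    by (rule has_integral_eq[rotated]) (rule det)
  then have "(\<integral>\<^sup>+ v. ennreal (indicator T v * v $ 1) \<partial>lborel) = ennreal (measure lebesgue B)"
    by (rule nn_integral_has_integral_lebesgue[rotated]) (simp add: T_def S_def)
  also have "(\<lambda>v. ennreal (indicator T v * v $ 1)) = (\<lambda>v. indicator T v * ennreal (v $ 1))"
    by (auto simp: indicator_def)
  also have "measure lebesgue B = (Re u - Re l) * (Im u - Im l)"
    using le by (simp add: B_def measure_lborel_box_eq Basis_vec_def UNIV_2 axis_eq_axis inner_axis)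
  finally show ?thesis by (simp add: T_def)
qed

text \<open>Boxes determine Lebesgue measure, and on boxes this is
  \<open>emeasure_polar_vec2_box\<close>. As an equality of measures it transfers null sets and
  integrals alike.\<close>

lemma lborel_complex_polar:
  "(lborel :: complex measure) =
    distr (density (lborel \<Otimes>\<^sub>M lborel) (\<lambda>p. indicator ({0<..} \<times> {0<..<2 * pi}) p * ennreal (fst p)))
      borel (\<lambda>p. rcis (fst p) (snd p))"
proof (rule lborel_eqI)
  fix l u :: complex
  assume le: "\<And>b. b \<in> Basis \<Longrightarrow> l \<bullet> b \<le> u \<bullet> b"
  have le': "Re l \<le> Re u" "Im l \<le> Im u"
    using le[of 1] le[of \<i>] by (auto simp: Basis_complex_def)
  define D :: "real \<times> real \<Rightarrow> ennreal" where "D p = indicator ({0<..} \<times> {0<..<2 * pi}) p * ennreal (fst p)" for p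
  have polar_m [measurable]: "(\<lambda>p. rcis (fst p) (snd p)) \<in> borel \<Otimes>\<^sub>M borel \<rightarrow>\<^sub>M borel"
    unfolding borel_prod rcis_def cis.code Complex_eq
    by (intro borel_measurable_continuous_onI continuous_intros)
  have [measurable]: "D \<in> borel_measurable (borel \<Otimes>\<^sub>M borel)"
    unfolding D_def by (intro borel_measurable_times_ennreal borel_measurable_indicator) (auto intro!: pair_measureI)
  have [measurable]: "box l u \<in> sets borel" by simp
  have box_m: "(\<lambda>p. rcis (fst p) (snd p)) -` box l u \<in> sets (borel \<Otimes>\<^sub>M borel)"
    using measurable_sets[OF polar_m, of "box l u"] by (simp add: space_pair_measure)
  have m: "(\<lambda>v::real^2. (v $ 1, v $ 2)) \<in> borel_measurable borel"
    by (intro borel_measurable_continuous_onI continuous_intros)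
  let ?h = "\<lambda>p. D p * indicator ((\<lambda>p. rcis (fst p) (snd p)) -` box l u) p"
  have hm: "?h \<in> borel_measurable borel"
  proof -
    have "?h \<in> borel_measurable (borel \<Otimes>\<^sub>M borel)"
      by (intro borel_measurable_times_ennreal borel_measurable_indicator) (auto simp: box_m)
    then show ?thesis by (simp add: borel_prod)
  qed
  have "emeasure (distr (density (lborel \<Otimes>\<^sub>M lborel) D) borel (\<lambda>p. rcis (fst p) (snd p))) (box l u) =
     (\<integral>\<^sup>+ p. ?h p \<partial>(lborel \<Otimes>\<^sub>M lborel))"
    by (subst emeasure_distr, simp, simp, subst emeasure_density) (auto simp: space_pair_measure box_m)
  also have "\<dots> = (\<integral>\<^sup>+ v. ?h (v $ 1, v $ 2) \<partial>(lborel :: (real^2) measure))"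
    unfolding lborel_prod lborel_vec2_pair using m hm by (subst nn_integral_distr) auto
  also have "\<dots> = (\<integral>\<^sup>+ v. indicator {v \<in> {v :: real^2. 0 < v $ 1 \<and> 0 < v $ 2 \<and> v $ 2 < 2 * pi}. rcis (v $ 1) (v $ 2) \<in> box l u} v * ennreal (v $ 1) \<partial>lborel)"
    by (intro nn_integral_cong) (auto simp: D_def indicator_def)
  also have "\<dots> = ennreal ((Re u - Re l) * (Im u - Im l))"
    by (rule emeasure_polar_vec2_box[OF le'])
  also have "(Re u - Re l) * (Im u - Im l) = (\<Prod>b\<in>Basis. (u - l) \<bullet> b)"
    by (simp add: Basis_complex_def)
  finally show "emeasure (distr (density (lborel \<Otimes>\<^sub>M lborel) (\<lambda>p. indicator ({0<..} \<times> {0<..<2 * pi}) p * ennreal (fst p)))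
      borel (\<lambda>p. rcis (fst p) (snd p))) (box l u) = (\<Prod>b\<in>Basis. (u - l) \<bullet> b)"
    unfolding D_def .
qed simp

lemma polar_measurable [measurable]: "(\<lambda>p. rcis (fst p) (snd p)) \<in> borel \<Otimes>\<^sub>M borel \<rightarrow>\<^sub>M borel"
  unfolding borel_prod rcis_def cis.code Complex_eq
  by (intro borel_measurable_continuous_onI continuous_intros)

lemma AE_polar:
  assumes "AE z in lborel. P z"
  shows "AE r in lborel. r > 0 \<longrightarrow> (AE t in lborel. t \<in> {0<..<2 * pi} \<longrightarrow> P (rcis r t))"
proof -
  \<comment> \<open>\<open>P\<close> need not be measurable, so Fubini's theorem is applied to a
    Borel null set that covers its exceptions.\<close>
  obtain N where N: "N \<in> null_sets lborel" "{z. \<not> P z} \<subseteq> N"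
    using assms by (auto elim!: AE_E simp: null_sets_def)
  from N have "AE z in lborel. z \<notin> N" by (auto intro: AE_not_in)
  then have "AE p in lborel \<Otimes>\<^sub>M (lborel :: real measure).
      0 < indicator ({0<..} \<times> {0<..<2 * pi}) p * ennreal (fst p) \<longrightarrow> rcis (fst p) (snd p) \<notin> N"
    using N(1) by (subst (asm) lborel_complex_polar)
      (subst (asm) AE_distr_iff, auto simp: AE_density)
  then have "AE r in lborel. AE t in lborel. r > 0 \<longrightarrow> t \<in> {0<..<2 * pi} \<longrightarrow> rcis r t \<notin> N"
    by (rule lborel_pair.AE_pair[THEN AE_mp]) (auto intro!: AE_I2 elim!: eventually_mono simp: indicator_def)
  then show ?thesis
    using N(2) by (auto elim!: eventually_mono)
qed

lemma integral_polar_borel: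
  fixes F :: "complex \<Rightarrow> complex"
  assumes F: "integrable lborel F"
  shows "integral\<^sup>L lborel F =
    (LINT r|lborel. indicator {0<..} r *\<^sub>R (of_real r * (LINT t|lborel. indicator {0<..<2 * pi} t *\<^sub>R F (rcis r t))))"
proof -
  have Fm [measurable]: "F \<in> borel_measurable borel" using F by auto
  define d :: "real \<times> real \<Rightarrow> real" where "d p = indicator ({0<..} \<times> {0<..<2 * pi}) p * fst p" for p
  have d: "indicator ({0<..} \<times> {0<..<2 * pi}) p * ennreal (fst p) = ennreal (d p)" for p
    by (auto simp: d_def indicator_def)
  have d0: "d p \<ge> 0" for p by (auto simp: d_def indicator_def)
  have [measurable]: "d \<in> borel_measurable (borel \<Otimes>\<^sub>M borel)"
    unfolding d_def by (intro borel_measurable_times borel_measurable_indicator) (auto intro!: pair_measureI)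
  have int: "integrable (lborel \<Otimes>\<^sub>M lborel) (\<lambda>p. d p *\<^sub>R F (rcis (fst p) (snd p)))"
    using F by (subst (asm) lborel_complex_polar)
      (subst (asm) integrable_distr_eq, auto simp: d integrable_density d0)
  have "integral\<^sup>L lborel F = (LINT p|(lborel \<Otimes>\<^sub>M lborel). d p *\<^sub>R F (rcis (fst p) (snd p)))"
    by (subst lborel_complex_polar, subst integral_distr) (auto simp: d integral_density d0)
  also have "\<dots> = (LINT r|lborel. LINT t|lborel. d (r, t) *\<^sub>R F (rcis r t))"
    using lborel_pair.integral_fst'[OF int] by simp
  also have "\<dots> = (LINT r|lborel. indicator {0<..} r *\<^sub>R (of_real r * (LINT t|lborel. indicator {0<..<2 * pi} t *\<^sub>R F (rcis r t))))"
  proof (intro Bochner_Integration.integral_cong refl)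
    fix r :: real
    have "(LINT t|lborel. d (r, t) *\<^sub>R F (rcis r t)) =
        (LINT t|lborel. of_real (indicator {0<..} r * r) * (indicator {0<..<2 * pi} t *\<^sub>R F (rcis r t)))"
      by (intro Bochner_Integration.integral_cong refl) (auto simp: d_def indicator_def scaleR_conv_of_real)
    also have "\<dots> = of_real (indicator {0<..} r * r) * (LINT t|lborel. indicator {0<..<2 * pi} t *\<^sub>R F (rcis r t))"
      by (rule integral_mult_right_zero)
    finally show "(LINT t|lborel. d (r, t) *\<^sub>R F (rcis r t)) = indicator {0<..} r *\<^sub>R (of_real r * (LINT t|lborel. indicator {0<..<2 * pi} t *\<^sub>R F (rcis r t)))"
      by (simp add: scaleR_conv_of_real mult.assoc)
  qed
  finally show ?thesis .
qed

section \<open>Lebesgue measurable functions and their Borel representatives\<close>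

text \<open>Lebesgue measure is complete. That measurability of \<open>f\<close> is a conclusion
  matters for the slices of a Lebesgue measurable function along circles, about which nothing is
  known beforehand.\<close>

lemma borel_measurable_lebesgue_AE:
  fixes f g :: "'a::euclidean_space \<Rightarrow> 'b::topological_space"
  assumes g: "g \<in> borel_measurable borel" and fg: "AE x in lborel. f x = g x"
  shows "f \<in> borel_measurable lebesgue"
proof (rule measurableI)
  fix A :: "'b set" assume "A \<in> sets borel"
  then have sets: "g -` A \<in> sets lebesgue"
    using measurable_sets_borel[OF g] by auto
  have ae: "AE x in lebesgue. x \<in> g -` A \<longleftrightarrow> x \<in> f -` A"
    using fg by (intro AE_completion) (auto elim!: eventually_mono)
  show "f -` A \<inter> space lebesgue \<in> sets lebesgue"
    using completion.in_sets_AE[OF ae sets] by simp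
qed simp

lemma integral_lebesgue_eq_lborel_AE:
  fixes f g :: "'a::euclidean_space \<Rightarrow> complex"
  assumes g: "g \<in> borel_measurable borel" and fg: "AE x in lborel. f x = g x"
  shows "integral\<^sup>L lebesgue f = integral\<^sup>L lborel g"
proof -
  have gm: "g \<in> borel_measurable lebesgue" using g by (simp add: measurable_completion)
  have "integral\<^sup>L lebesgue f = integral\<^sup>L lebesgue g"
    using gm fg borel_measurable_lebesgue_AE[OF assms] by (intro integral_cong_AE AE_completion)
  also have "\<dots> = integral\<^sup>L lborel g" using g by (simp add: integral_completion)
  finally show ?thesis .
qed

lemma lebesgue_ex_borel_complex:
  fixes f :: "'a::euclidean_space \<Rightarrow> complex"
  assumes f: "f \<in> borel_measurable lebesgue"
  shows "\<exists>g\<in>borel_measurable borel. AE x in lborel. f x = g x"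
proof -
  have "(\<lambda>x. Re (f x)) \<in> borel_measurable (completion lborel)" "(\<lambda>x. Im (f x)) \<in> borel_measurable (completion lborel)"
    using f by auto
  from this[THEN completion_ex_borel_measurable_real] obtain a b
    where ab: "a \<in> borel_measurable lborel" "b \<in> borel_measurable lborel"
      "AE x in lborel. Re (f x) = a x" "AE x in lborel. Im (f x) = b x" by blast
  have "AE x in lborel. f x = Complex (a x) (b x)"
    using ab(3,4) by eventually_elim (simp add: complex_eq_iff)
  moreover have [measurable]: "a \<in> borel_measurable borel" "b \<in> borel_measurable borel"
    using ab(1,2) by simp_all
  have "(\<lambda>x. Complex (a x) (b x)) \<in> borel_measurable borel"
    unfolding Complex_eq by measurable
  ultimately show ?thesis by (rule rev_bexI[rotated])
qed

section \<open>Integration over the normalized disk measure\<close>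

lemma integrable_disk_measure_iff:
  fixes F :: "complex \<Rightarrow> 'b::{banach, second_countable_topology}"
  shows "integrable disk_measure F \<longleftrightarrow> integrable lebesgue (\<lambda>z. indicator (ball 0 1) z *\<^sub>R F z)"
proof -
  have scale: "integrable (lebesgue_on (ball 0 1)) (\<lambda>z. (1 / pi) *\<^sub>R F z) \<longleftrightarrow> integrable (lebesgue_on (ball 0 1)) F"
    using integrable_scaleR_right[of pi "lebesgue_on (ball 0 1)" "\<lambda>z. (1 / pi) *\<^sub>R F z"]
      integrable_scaleR_right[of "1 / pi" "lebesgue_on (ball 0 1)" F] by auto
  have "integrable disk_measure F \<longleftrightarrow> integrable (lebesgue_on (ball 0 1)) (\<lambda>z. (1 / pi) *\<^sub>R F z)"
  \<comment> \<open>The rule for densities presupposes measurability. Otherwise neither side is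
    integrable, because the two measures have the same measurable sets.\<close>
  proof (cases "F \<in> borel_measurable (lebesgue_on (ball 0 1))")
    case True
    then show ?thesis unfolding disk_measure_def by (subst integrable_density) auto
  next
    case False
    moreover have "sets disk_measure = sets (lebesgue_on (ball 0 1))"
      by (simp add: disk_measure_def)
    ultimately show ?thesis
      unfolding scale by (metis borel_measurable_integrable measurable_cong_sets)
  qed
  also have "\<dots> \<longleftrightarrow> integrable (lebesgue_on (ball 0 1)) F" by (rule scale)
  also have "\<dots> \<longleftrightarrow> integrable lebesgue (\<lambda>z. indicator (ball 0 1) z *\<^sub>R F z)"
    by (rule integrable_restrict_space) simp
  finally show ?thesis .
qed

lemma integral_disk_measure:
  fixes F :: "complex \<Rightarrow> complex"
  assumes "F \<in> borel_measurable disk_measure"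
  shows "integral\<^sup>L disk_measure F = (1 / pi) *\<^sub>R integral\<^sup>L lebesgue (\<lambda>z. indicator (ball 0 1) z *\<^sub>R F z)"
proof -
  have "integral\<^sup>L disk_measure F = integral\<^sup>L (lebesgue_on (ball 0 1)) (\<lambda>z. (1 / pi) *\<^sub>R F z)"
    using assms unfolding disk_measure_def by (subst integral_density) auto
  also have "\<dots> = (1 / pi) *\<^sub>R integral\<^sup>L (lebesgue_on (ball 0 1)) F" by (rule integral_scaleR_right)
  finally show ?thesis by (simp add: integral_restrict_space)
qed

text \<open>The integrand is exchanged for a Borel function \<open>G\<close>, and on almost every
  circle the two agree almost everywhere. The factor \<open>1 / (2 * pi)\<close> stays inside to
  match \<open>angular_coeff\<close>; the 2 in front is what this leaves of the normalization
  \<open>1 / pi\<close>.\<close>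

lemma integral_disk_polar:
  fixes F :: "complex \<Rightarrow> complex"
  assumes F: "integrable disk_measure F"
  shows "integral\<^sup>L disk_measure F =
    2 * (LINT r|lebesgue_on {0..<1}. 1 / (2 * pi) * (LINT t|lebesgue_on {0..2 * pi}. F (rcis r t)) * of_real r)"
proof -
  define H where "H z = indicator (ball 0 1) z *\<^sub>R F z" for z :: complex
  have H: "integrable lebesgue H" using F unfolding H_def integrable_disk_measure_iff .
  then obtain G where G [measurable]: "G \<in> borel_measurable borel" and HG: "AE z in lborel. H z = G z"
    using lebesgue_ex_borel_complex[of H] by auto
  have "integrable lebesgue G"
    using H G HG by (subst integrable_cong_AE[of G _ H])
      (auto simp: measurable_completion eq_commute intro!: AE_completion)
  then have intG: "integrable lborel G" using G by (simp add: integrable_completion)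
  define J where "J r = (LINT t|lborel. indicator {0<..<2 * pi} t *\<^sub>R G (rcis r t))" for r
  have rcis_m [measurable]: "(\<lambda>t. rcis r t) \<in> borel_measurable borel" for r
    unfolding rcis_def cis.code Complex_eq by (intro borel_measurable_continuous_onI continuous_intros)
  \<comment> \<open>The value 0 at radii from 1 on reflects that \<open>H\<close> is cut off outside
    the disk.\<close>
  have inner: "AE r in lborel. r > 0 \<longrightarrow>
      (if r < 1 then LINT t|lebesgue_on {0..2 * pi}. F (rcis r t) else 0) = J r"
    using AE_polar[OF HG]
  proof eventually_elim
    case (elim r)
    show ?case
    proof
      assume r: "r > 0"
      let ?f = "\<lambda>t. indicator {0..2 * pi} t *\<^sub>R (if r < 1 then F (rcis r t) else 0)"
      let ?g = "\<lambda>t. indicator {0<..<2 * pi} t *\<^sub>R G (rcis r t)"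
      have "AE t in lborel. ?f t = ?g t"
        using elim[rule_format, OF r] AE_lborel_singleton[of 0] AE_lborel_singleton[of "2 * pi"]
        by eventually_elim (use r in \<open>auto simp: indicator_def H_def norm_mult split: if_splits\<close>)
      then have "integral\<^sup>L lebesgue ?f = J r"
        unfolding J_def by (intro integral_lebesgue_eq_lborel_AE) measurable
      then show "(if r < 1 then LINT t|lebesgue_on {0..2 * pi}. F (rcis r t) else 0) = J r"
        by (auto simp: integral_restrict_space)
    qed
  qed
  have Jm [measurable]: "J \<in> borel_measurable borel"
  proof -
    have "(\<lambda>(r, t). indicator {0<..<2 * pi} t *\<^sub>R G (rcis r t)) \<in> borel_measurable (borel \<Otimes>\<^sub>M lborel)"
      using measurable_compose[OF polar_measurable G] by (simp add: case_prod_beta)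
    from lborel.borel_measurable_lebesgue_integral[OF this] show ?thesis
      unfolding J_def by simp
  qed
  have "integral\<^sup>L disk_measure F = (1 / pi) *\<^sub>R integral\<^sup>L lebesgue H"
    unfolding H_def using F by (intro integral_disk_measure) auto
  also have "integral\<^sup>L lebesgue H = integral\<^sup>L lborel G"
    by (rule integral_lebesgue_eq_lborel_AE[OF G HG])
  also have "\<dots> = (LINT r|lborel. indicator {0<..} r *\<^sub>R (of_real r * J r))"
    unfolding J_def by (rule integral_polar_borel[OF intG])
  also have "\<dots> = (LINT r|lebesgue. indicator {0..<1} r *\<^sub>R (of_real r * (LINT t|lebesgue_on {0..2 * pi}. F (rcis r t))))"
  proof (intro integral_lebesgue_eq_lborel_AE[symmetric])
    show "AE r in lborel. indicator {0..<1} r *\<^sub>R (of_real r * (LINT t|lebesgue_on {0..2 * pi}. F (rcis r t))) =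
        indicator {0<..} r *\<^sub>R (of_real r * J r)"
      using inner by eventually_elim (auto simp: indicator_def not_less split: if_splits)
  qed measurable
  also have "\<dots> = (LINT r|lebesgue_on {0..<1}. of_real r * (LINT t|lebesgue_on {0..2 * pi}. F (rcis r t)))"
    by (simp add: integral_restrict_space)
  also have "(1 / pi) *\<^sub>R \<dots> = 2 * (1 / (2 * pi) * \<dots>)"
    by (simp add: scaleR_conv_of_real)
  also have "\<dots> = 2 * (LINT r|lebesgue_on {0..<1}. 1 / (2 * pi) * (of_real r * (LINT t|lebesgue_on {0..2 * pi}. F (rcis r t))))"
    by (simp only: integral_mult_right_zero)
  also have "\<dots> = 2 * (LINT r|lebesgue_on {0..<1}. 1 / (2 * pi) * (LINT t|lebesgue_on {0..2 * pi}. F (rcis r t)) * of_real r)"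
    by (simp add: mult_ac)
  finally show ?thesis .
qed

section \<open>The Bergman projection\<close>

lemma of_nat_add_1_neq_0: "of_nat j + 1 \<noteq> (0 :: complex)"
  using of_nat_neq_0[of j, where ?'a = complex] by (simp add: add.commute)

lemma sets_disk_measure: "sets disk_measure = sets (lebesgue_on (ball 0 1))"
  by (simp add: disk_measure_def)

lemma space_disk_measure [simp]: "space disk_measure = ball 0 1"
  by (simp add: disk_measure_def)

lemma integrable_disk_const [simp]: "integrable disk_measure (\<lambda>_. c :: 'b::{banach, second_countable_topology})"
  unfolding integrable_disk_measure_iff
  using emeasure_lborel_ball_finite[of "0 :: complex" 1]
  by (intro integrable_scaleR_left integrable_real_indicator) auto

lemma finite_measure_disk_measure: "finite_measure disk_measure"
proof (rule finite_measureI)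
  have "emeasure disk_measure (ball 0 1) = ennreal (1 / pi) * emeasure lborel (ball (0 :: complex) 1)"
    by (simp add: disk_measure_def emeasure_density_const emeasure_restrict_space)
  then show "emeasure disk_measure (space disk_measure) \<noteq> \<infinity>"
    using emeasure_lborel_ball_finite[of "0 :: complex" 1] by (simp add: ennreal_mult_eq_top_iff less_top)
qed

interpretation disk: finite_measure disk_measure
  by (rule finite_measure_disk_measure)

lemma continuous_on_measurable_disk:
  fixes u :: "complex \<Rightarrow> 'b::{second_countable_topology, real_normed_vector}"
  assumes "continuous_on (ball 0 1) u"
  shows "u \<in> borel_measurable disk_measure"
proof -
  have "u \<in> borel_measurable (lebesgue_on (ball 0 1))"
    using assms by (intro continuous_imp_measurable_on_sets_lebesgue) auto
  then show ?thesis
    by (simp add: disk_measure_def)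
qed

lemma borel_measurable_cnj [measurable (raw)]:
  "f \<in> borel_measurable M \<Longrightarrow> (\<lambda>x. cnj (f x)) \<in> borel_measurable M"
  by (rule measurable_compose[OF _ borel_measurable_continuous_onI]) (auto intro: continuous_intros)

lemma L2_diskD:
  assumes "u \<in> L2_disk"
  shows "u \<in> borel_measurable disk_measure" "integrable disk_measure (\<lambda>z. (cmod (u z))\<^sup>2)"
  using assms by (auto simp: L2_disk_def)

lemma L2_disk_bounded:
  assumes "u \<in> borel_measurable disk_measure" "\<And>z. z \<in> ball 0 1 \<Longrightarrow> cmod (u z) \<le> C"
  shows "u \<in> L2_disk"
  unfolding L2_disk_def
proof (safe intro!: assms(1))
  show "integrable disk_measure (\<lambda>z. (cmod (u z))\<^sup>2)"
    using assms
    by (intro disk.integrable_const_bound[of _ "C\<^sup>2"]) (auto intro!: power_mono AE_I2)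
qed

lemma L2_disk_mult_bounded:
  assumes u: "u \<in> L2_disk" and w: "w \<in> borel_measurable disk_measure" "\<And>z. z \<in> ball 0 1 \<Longrightarrow> cmod (w z) \<le> C"
  shows "(\<lambda>z. u z * w z) \<in> L2_disk"
  unfolding L2_disk_def
proof safe
  show [measurable]: "(\<lambda>z. u z * w z) \<in> borel_measurable disk_measure"
    using L2_diskD[OF u] w by auto
  show "integrable disk_measure (\<lambda>z. (cmod (u z * w z))\<^sup>2)"
  proof (rule Bochner_Integration.integrable_bound)
    show "integrable disk_measure (\<lambda>z. C\<^sup>2 * (cmod (u z))\<^sup>2)" using L2_diskD[OF u] by auto
    show "AE z in disk_measure. norm ((cmod (u z * w z))\<^sup>2) \<le> norm (C\<^sup>2 * (cmod (u z))\<^sup>2)"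
      using w(2) by (auto intro!: AE_I2 mult_left_mono power_mono simp: norm_mult power_mult_distrib mult.commute[of "C\<^sup>2"])
  qed measurable
qed

lemma L2_disk_poly_mult:
  assumes "u \<in> L2_disk"
  shows "(\<lambda>z. u z * poly p z) \<in> L2_disk"
proof -
  have "compact (poly p ` cball 0 1)"
    by (intro compact_continuous_image continuous_intros) simp
  then obtain C where C: "\<And>z. z \<in> cball 0 1 \<Longrightarrow> cmod (poly p z) \<le> C"
    by (meson bounded_iff compact_imp_bounded imageI)
  show ?thesis
    using C by (intro L2_disk_mult_bounded[OF assms, of _ C] continuous_on_measurable_disk continuous_intros) auto
qed

lemma power_in_L2_disk: "(\<lambda>z. z ^ n) \<in> L2_disk"
  by (intro L2_disk_bounded[of _ 1] continuous_on_measurable_disk continuous_intros)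
     (auto simp: norm_power intro: power_le_one)

lemma L2_disk_cong:
  assumes "u \<in> L2_disk" "\<And>z. z \<in> ball 0 1 \<Longrightarrow> u z = v z"
  shows "v \<in> L2_disk"
proof -
  have "v \<in> borel_measurable disk_measure"
    using L2_diskD(1)[OF assms(1)] assms(2) by (subst measurable_cong[of _ v u]) auto
  moreover have "integrable disk_measure (\<lambda>z. (cmod (v z))\<^sup>2)"
    using L2_diskD(2)[OF assms(1)] assms(2)
    by (subst Bochner_Integration.integrable_cong[OF refl, of _ _ "\<lambda>z. (cmod (u z))\<^sup>2"]) auto
  ultimately show ?thesis by (simp add: L2_disk_def)
qed

lemma L2_inner_cong:
  assumes "\<And>z. z \<in> ball 0 1 \<Longrightarrow> u z = u' z" "\<And>z. z \<in> ball 0 1 \<Longrightarrow> v z = v' z"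
  shows "L2_inner u v = L2_inner u' v'"
  unfolding L2_inner_def using assms by (intro Bochner_Integration.integral_cong) auto

lemma integrable_L2_inner:
  assumes u: "u \<in> L2_disk" and v: "v \<in> L2_disk"
  shows "integrable disk_measure (\<lambda>z. u z * cnj (v z))"
proof (rule Bochner_Integration.integrable_bound)
  note [measurable] = L2_diskD(1)[OF u] L2_diskD(1)[OF v]
  show "integrable disk_measure (\<lambda>z. (cmod (u z))\<^sup>2 + (cmod (v z))\<^sup>2)"
    using L2_diskD(2)[OF u] L2_diskD(2)[OF v] by auto
  show "AE z in disk_measure. norm (u z * cnj (v z)) \<le> norm ((cmod (u z))\<^sup>2 + (cmod (v z))\<^sup>2)"
  proof (rule AE_I2)
    fix z
    have "2 * (cmod (u z) * cmod (v z)) \<le> (cmod (u z))\<^sup>2 + (cmod (v z))\<^sup>2"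
      using sum_squares_bound[of "cmod (u z)" "cmod (v z)"] by simp
    moreover have "0 \<le> cmod (u z) * cmod (v z)" by simp
    ultimately have "cmod (u z) * cmod (v z) \<le> (cmod (u z))\<^sup>2 + (cmod (v z))\<^sup>2"
      by linarith
    then show "norm (u z * cnj (v z)) \<le> norm ((cmod (u z))\<^sup>2 + (cmod (v z))\<^sup>2)"
      by (simp add: norm_mult)
  qed
  show "(\<lambda>z. u z * cnj (v z)) \<in> borel_measurable disk_measure"
    by measurable
qed

lemma L2_disk_add:
  assumes u: "u \<in> L2_disk" and v: "v \<in> L2_disk"
  shows "(\<lambda>z. u z + v z) \<in> L2_disk"
  unfolding L2_disk_def
proof safe
  note [measurable] = L2_diskD(1)[OF u] L2_diskD(1)[OF v]
  show "(\<lambda>z. u z + v z) \<in> borel_measurable disk_measure" by measurable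
  show "integrable disk_measure (\<lambda>z. (cmod (u z + v z))\<^sup>2)"
  proof (rule Bochner_Integration.integrable_bound)
    show "integrable disk_measure (\<lambda>z. 2 * ((cmod (u z))\<^sup>2 + (cmod (v z))\<^sup>2))"
      using L2_diskD(2)[OF u] L2_diskD(2)[OF v] by auto
    show "AE z in disk_measure. norm ((cmod (u z + v z))\<^sup>2) \<le> norm (2 * ((cmod (u z))\<^sup>2 + (cmod (v z))\<^sup>2))"
    proof (rule AE_I2)
      fix z
      have "(cmod (u z + v z))\<^sup>2 \<le> (cmod (u z) + cmod (v z))\<^sup>2"
        by (intro power_mono norm_triangle_ineq) auto
      also have "\<dots> \<le> 2 * ((cmod (u z))\<^sup>2 + (cmod (v z))\<^sup>2)"
        using sum_squares_bound[of "cmod (u z)" "cmod (v z)"] by (simp add: power2_sum)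
      finally show "norm ((cmod (u z + v z))\<^sup>2) \<le> norm (2 * ((cmod (u z))\<^sup>2 + (cmod (v z))\<^sup>2))" by simp
    qed
  qed measurable
qed

lemma L2_disk_cmult: "u \<in> L2_disk \<Longrightarrow> (\<lambda>z. c * u z) \<in> L2_disk"
  using L2_disk_mult_bounded[of u "\<lambda>_. c" "cmod c"] by (simp add: mult.commute)

lemma L2_disk_diff: "u \<in> L2_disk \<Longrightarrow> v \<in> L2_disk \<Longrightarrow> (\<lambda>z. u z - v z) \<in> L2_disk"
  using L2_disk_add[of u "\<lambda>z. -1 * v z"] L2_disk_cmult[of v "-1"] by simp

lemma L2_disk_zero: "(\<lambda>_. 0) \<in> L2_disk"
  by (simp add: L2_disk_def)

lemma L2_disk_sum: "(\<And>i. i \<in> I \<Longrightarrow> u i \<in> L2_disk) \<Longrightarrow> (\<lambda>z. \<Sum>i\<in>I. u i z) \<in> L2_disk"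
  by (induction I rule: infinite_finite_induct) (auto intro: L2_disk_add simp: L2_disk_zero)

lemma L2_inner_add_left:
  "u \<in> L2_disk \<Longrightarrow> v \<in> L2_disk \<Longrightarrow> w \<in> L2_disk \<Longrightarrow> L2_inner (\<lambda>z. u z + v z) w = L2_inner u w + L2_inner v w"
  unfolding L2_inner_def by (simp add: distrib_right integrable_L2_inner)

lemma L2_inner_diff_left:
  "u \<in> L2_disk \<Longrightarrow> v \<in> L2_disk \<Longrightarrow> w \<in> L2_disk \<Longrightarrow> L2_inner (\<lambda>z. u z - v z) w = L2_inner u w - L2_inner v w"
  unfolding L2_inner_def by (simp add: left_diff_distrib integrable_L2_inner)

lemma L2_inner_cmult_left: "L2_inner (\<lambda>z. c * u z) w = c * L2_inner u w"
  unfolding L2_inner_def by (simp add: mult.assoc)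

lemma L2_inner_commute: "L2_inner v u = cnj (L2_inner u v)"
  unfolding L2_inner_def using Bochner_Integration.integral_cnj[of disk_measure "\<lambda>z. u z * cnj (v z)"]
  by (simp add: mult.commute)

lemma L2_inner_sum_left:
  assumes "\<And>i. i \<in> I \<Longrightarrow> u i \<in> L2_disk" "w \<in> L2_disk"
  shows "L2_inner (\<lambda>z. \<Sum>i\<in>I. u i z) w = (\<Sum>i\<in>I. L2_inner (u i) w)"
  unfolding L2_inner_def using assms by (simp add: sum_distrib_right integrable_L2_inner)

lemma L2_inner_sum_right:
  assumes "\<And>i. i \<in> I \<Longrightarrow> u i \<in> L2_disk" "w \<in> L2_disk"
  shows "L2_inner w (\<lambda>z. \<Sum>i\<in>I. u i z) = (\<Sum>i\<in>I. L2_inner w (u i))"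
  using assms by (simp add: L2_inner_commute[of w] L2_inner_sum_left)

lemma L2_inner_cmult_right: "L2_inner w (\<lambda>z. c * u z) = cnj c * L2_inner w u"
  by (simp add: L2_inner_commute[of w] L2_inner_cmult_left)

lemma L2_inner_diff_right:
  "u \<in> L2_disk \<Longrightarrow> v \<in> L2_disk \<Longrightarrow> w \<in> L2_disk \<Longrightarrow> L2_inner w (\<lambda>z. u z - v z) = L2_inner w u - L2_inner w v"
  by (simp add: L2_inner_commute[of w] L2_inner_diff_left)

lemma L2_inner_self: "L2_inner u u = of_real (LINT z|disk_measure. (cmod (u z))\<^sup>2)"
  unfolding L2_inner_def complex_norm_square[symmetric] by (simp only: integral_complex_of_real)

text \<open>The inequality of arithmetic and geometric means, integrated, with a factor 2 given
  away. The free parameter \<open>t\<close> does the work of the Cauchy-Schwarz inequality in limit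
  arguments without square roots.\<close>

lemma L2_inner_Young:
  assumes "u \<in> L2_disk" "v \<in> L2_disk" "t > 0"
  shows "cmod (L2_inner u v) \<le> t * (LINT z|disk_measure. (cmod (u z))\<^sup>2) + (LINT z|disk_measure. (cmod (v z))\<^sup>2) / t"
proof -
  have "cmod (L2_inner u v) \<le> (LINT z|disk_measure. cmod (u z * cnj (v z)))"
    unfolding L2_inner_def by (rule integral_norm_bound)
  also have "\<dots> \<le> (LINT z|disk_measure. t * (cmod (u z))\<^sup>2 + (cmod (v z))\<^sup>2 / t)"
  proof (rule integral_mono)
    fix z
    have "0 \<le> (t * cmod (u z) - cmod (v z))\<^sup>2 + 2 * (cmod (v z))\<^sup>2 * 0" by simp
    then have "2 * t * (cmod (u z) * cmod (v z)) \<le> t\<^sup>2 * (cmod (u z))\<^sup>2 + (cmod (v z))\<^sup>2"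
      by (simp add: power2_diff power_mult_distrib algebra_simps)
    moreover have "0 \<le> t * (cmod (u z) * cmod (v z))" using assms by simp
    ultimately have "t * (cmod (u z) * cmod (v z)) \<le> t\<^sup>2 * (cmod (u z))\<^sup>2 + (cmod (v z))\<^sup>2"
      by linarith
    then show "cmod (u z * cnj (v z)) \<le> t * (cmod (u z))\<^sup>2 + (cmod (v z))\<^sup>2 / t"
      using assms by (simp add: norm_mult field_simps power2_eq_square)
  qed (use assms L2_diskD in \<open>auto intro!: integrable_norm integrable_L2_inner\<close>)
  also have "\<dots> = t * (LINT z|disk_measure. (cmod (u z))\<^sup>2) + (LINT z|disk_measure. (cmod (v z))\<^sup>2) / t"
    using assms L2_diskD by simp
  finally show ?thesis .
qed

lemma L2_inner_tendsto:
  assumes u: "u \<in> L2_disk" and v: "v \<in> L2_disk" "\<And>n. w n \<in> L2_disk"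
    and lim: "(\<lambda>n. LINT z|disk_measure. (cmod (v z - w n z))\<^sup>2) \<longlonglongrightarrow> 0"
  shows "(\<lambda>n. L2_inner u (w n)) \<longlonglongrightarrow> L2_inner u v"
proof (rule LIMSEQ_I)
  fix e :: real assume e: "e > 0"
  define A where "A = (LINT z|disk_measure. (cmod (u z))\<^sup>2)"
  have A: "A \<ge> 0" by (simp add: A_def)
  \<comment> \<open>This makes the first term of the Young bound smaller than e / 2; the
    \<open>+ 1\<close> covers A = 0. The second term is smaller than e / 2 once the squared distance
    is below \<open>t * (e / 2)\<close>.\<close>
  define t where "t = e / (2 * (A + 1))"
  have t: "t > 0" using e A by (simp add: t_def)
  have tA: "t * A < e / 2"
    using e A by (simp add: t_def field_simps)
  have "eventually (\<lambda>n. (LINT z|disk_measure. (cmod (v z - w n z))\<^sup>2) < t * (e / 2)) sequentially"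
    using order_tendstoD(2)[OF lim, of "t * (e / 2)"] t e by simp
  then obtain N where N: "\<And>n. n \<ge> N \<Longrightarrow> (LINT z|disk_measure. (cmod (v z - w n z))\<^sup>2) < t * (e / 2)"
    by (auto simp: eventually_sequentially)
  show "\<exists>N. \<forall>n\<ge>N. norm (L2_inner u (w n) - L2_inner u v) < e"
  proof (intro exI[of _ N] allI impI)
    fix n assume n: "n \<ge> N"
    have "norm (L2_inner u (w n) - L2_inner u v) = cmod (L2_inner u (\<lambda>z. v z - w n z))"
      using u v by (simp add: L2_inner_diff_right norm_minus_commute)
    also have "\<dots> \<le> t * A + (LINT z|disk_measure. (cmod (v z - w n z))\<^sup>2) / t"
      unfolding A_def by (intro L2_inner_Young L2_disk_diff u v t)
    also have "(LINT z|disk_measure. (cmod (v z - w n z))\<^sup>2) / t < e / 2"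
      using N[OF n] t by (simp add: field_simps)
    finally show "norm (L2_inner u (w n) - L2_inner u v) < e"
      using tA by linarith
  qed
qed

section \<open>Orthogonality of the monomials and Parseval's formula\<close>

lemma integral_cis_period:
  fixes k :: int
  shows "(LINT t|lebesgue_on {0..2 * pi}. cis (of_int k * t)) = (if k = 0 then 2 * pi else 0)"
proof -
  have "continuous_on {0..2 * pi} (\<lambda>t. cis (of_int k * t))"
    by (intro continuous_intros)
  then have "(LINT t|lebesgue_on {0..2 * pi}. cis (of_int k * t)) = integral {0..2 * pi} (\<lambda>t. cis (of_int k * t))"
    by (intro lebesgue_integral_eq_integral continuous_imp_integrable_real) auto
  also have "((\<lambda>t. cis (of_int k * t)) has_integral (if k = 0 then 2 * pi else 0)) {0..2 * pi}"
  proof (cases "k = 0")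
    case True
    then show ?thesis using has_integral_const_real[of "1 :: complex" 0 "2 * pi"] by (simp add: scaleR_conv_of_real)
  next
    case False
    have "((\<lambda>t. cis (of_int k * t)) has_integral
        (cis (of_int k * (2 * pi)) / (\<i> * of_int k) - cis (of_int k * 0) / (\<i> * of_int k))) {0..2 * pi}"
    proof (rule fundamental_theorem_of_calculus)
      fix t :: real
      show "((\<lambda>t. cis (of_int k * t) / (\<i> * of_int k)) has_vector_derivative cis (of_int k * t)) (at t within {0..2 * pi})"
        unfolding cis_conv_exp using False
        by (auto intro!: derivative_eq_intros has_vector_derivative_real_field simp: field_simps)
    qed simp
    moreover have "cis (of_int k * (2 * pi)) = 1"
      using cis_multiple_2pi[of "of_int k"] by (simp add: mult_ac)
    ultimately show ?thesis using False by simp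
  qed
  then have "integral {0..2 * pi} (\<lambda>t. cis (of_int k * t)) = (if k = 0 then 2 * pi else 0)"
    by (rule integral_unique)
  finally show ?thesis .
qed

lemma integral_power_below:
  assumes "0 \<le> R" "R \<le> 1"
  shows "(LINT r|lebesgue_on {0..<1}. indicator {..<R} r *\<^sub>R complex_of_real (r ^ n)) = of_real (R ^ (n + 1) / (n + 1))"
proof -
  let ?g = "\<lambda>r. indicator {0..R} r *\<^sub>R complex_of_real (r ^ n)"
  have g: "?g \<in> borel_measurable borel"
    by (intro borel_measurable_scaleR borel_measurable_indicator borel_measurable_continuous_onI continuous_intros) auto
  have "(LINT r|lebesgue_on {0..<1}. indicator {..<R} r *\<^sub>R complex_of_real (r ^ n)) =
      (LINT r|lebesgue. indicator {0..<1} r *\<^sub>R (indicator {..<R} r *\<^sub>R complex_of_real (r ^ n)))"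
    by (simp add: integral_restrict_space)
  also have "\<dots> = integral\<^sup>L lborel ?g"
    using assms by (intro integral_lebesgue_eq_lborel_AE g eventually_mono[OF AE_lborel_singleton[of R]]) (auto simp: indicator_def)
  also have "\<dots> = integral\<^sup>L lebesgue ?g"
    by (intro integral_lebesgue_eq_lborel_AE[symmetric] g) simp
  also have "\<dots> = (LINT r|lebesgue_on {0..R}. complex_of_real (r ^ n))"
    by (simp add: integral_restrict_space)
  also have "\<dots> = of_real (LINT r|lebesgue_on {0..R}. r ^ n)"
    by (rule integral_complex_of_real)
  also have "(LINT r|lebesgue_on {0..R}. r ^ n) = integral {0..R} (\<lambda>r. r ^ n)"
    by (intro lebesgue_integral_eq_integral continuous_imp_integrable_real continuous_intros) auto
  also have "((\<lambda>r. r ^ n) has_integral (R ^ (n + 1) / (n + 1) - 0 ^ (n + 1) / (n + 1))) {0..R}"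
  proof (rule fundamental_theorem_of_calculus[OF assms(1)])
    fix x :: real
    have "((\<lambda>r. r ^ (n + 1) / (n + 1)) has_real_derivative (real (n + 1) * x ^ n) / (n + 1)) (at x within {0..R})"
      using DERIV_power_Suc[of "\<lambda>x. x" 1 x "{0..R}" n] by (intro DERIV_cdivide) (simp add: add.commute)
    then show "((\<lambda>r. r ^ (n + 1) / (n + 1)) has_vector_derivative x ^ n) (at x within {0..R})"
      by (simp flip: has_real_derivative_iff_has_vector_derivative)
  qed
  then have "integral {0..R} (\<lambda>r. r ^ n) = R ^ (n + 1) / (n + 1)"
    by (simp add: integral_unique)
  finally show ?thesis .
qed

text \<open>Integration over the angle leaves only i = j. In the exponent \<open>2 * i + 2\<close>
  one unit comes from the Jacobian r and one from integrating a power of r. Radii R < 1 serve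
  Parseval's formula, R = 1 the inner products of the Bergman space.\<close>

lemma monomial_orthogonal:
  assumes "0 \<le> R" "R \<le> 1"
  shows "(LINT z|disk_measure. indicator (ball 0 R) z *\<^sub>R (z ^ i * cnj (z ^ j))) =
    (if i = j then of_real (R ^ (2 * i + 2) / (i + 1)) else 0)"
proof -
  let ?F = "\<lambda>z. indicator (ball 0 R) z *\<^sub>R (z ^ i * cnj (z ^ j)) :: complex"
  have "integrable disk_measure (\<lambda>z. z ^ i * cnj (z ^ j))"
    by (intro integrable_L2_inner power_in_L2_disk)
  moreover have "ball 0 R \<in> sets disk_measure"
    using assms by (auto simp: sets_disk_measure sets_restrict_space_iff subset_ball)
  ultimately have "integrable disk_measure ?F"
    by (intro integrable_mult_indicator)
  then have "integral\<^sup>L disk_measure ?F =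
    2 * (LINT r|lebesgue_on {0..<1}. 1 / (2 * pi) * (LINT t|lebesgue_on {0..2 * pi}. ?F (rcis r t)) * of_real r)"
    by (rule integral_disk_polar)
  also have "(LINT r|lebesgue_on {0..<1}. 1 / (2 * pi) * (LINT t|lebesgue_on {0..2 * pi}. ?F (rcis r t)) * of_real r) =
     (LINT r|lebesgue_on {0..<1}. (if i = j then 1 else 0) * (indicator {..<R} r *\<^sub>R of_real (r ^ (i + j + 1))))"
  proof (intro Bochner_Integration.integral_cong refl)
    fix r :: real assume "r \<in> space (lebesgue_on {0..<1})"
    then have r: "0 \<le> r" "r < 1" by auto
    have "cis t ^ i * cnj (cis t ^ j) = cis (of_int (int i - int j) * t)" for t
      by (simp add: Complex.DeMoivre cis_cnj cis_mult algebra_simps)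
    then have "?F (rcis r t) = of_real (indicator {..<R} r * r ^ (i + j)) * cis (of_int (int i - int j) * t)" for t
      using r by (simp add: rcis_def indicator_def power_mult_distrib power_add norm_mult mult.assoc mult.left_commute[of _ "of_real r ^ j"])
    then have "(LINT t|lebesgue_on {0..2 * pi}. ?F (rcis r t)) =
        of_real (indicator {..<R} r * r ^ (i + j)) * (LINT t|lebesgue_on {0..2 * pi}. cis (of_int (int i - int j) * t))"
      by (simp only: integral_mult_right_zero)
    also have "(LINT t|lebesgue_on {0..2 * pi}. cis (of_int (int i - int j) * t)) = (if i = j then 2 * pi else 0)"
      by (subst integral_cis_period) auto
    finally show "1 / (2 * pi) * (LINT t|lebesgue_on {0..2 * pi}. ?F (rcis r t)) * of_real r =
        (if i = j then 1 else 0) * (indicator {..<R} r *\<^sub>R of_real (r ^ (i + j + 1)))"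
      by (simp add: scaleR_conv_of_real)
  qed
  also have "\<dots> = (if i = j then 1 else 0) * of_real (R ^ (i + j + 1 + 1) / real (i + j + 1 + 1))"
    by (simp only: integral_mult_right_zero integral_power_below[OF assms] of_nat_add of_nat_1)
  also have "2 * \<dots> = (if i = j then of_real (R ^ (2 * i + 2) / (i + 1)) else 0)"
  proof (cases "i = j")
    case True
    have e: "real (i + i + 1 + 1) = 2 * real (i + 1)" "i + i + 1 + 1 = 2 * i + 2"
      by simp_all
    have "2 * (R ^ (i + i + 1 + 1) / real (i + i + 1 + 1)) = 2 * (R ^ (2 * i + 2) / (2 * real (i + 1)))"
      by (rule arg_cong2[where f="\<lambda>k y. 2 * (R ^ k / y)", OF e(2) e(1)])
    also have "\<dots> = R ^ (2 * i + 2) / (i + 1)"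
      by (subst times_divide_eq_right, rule mult_divide_mult_cancel_left) simp
    finally have "complex_of_real (2 * (R ^ (i + i + 1 + 1) / real (i + i + 1 + 1))) = of_real (R ^ (2 * i + 2) / (i + 1))"
      by (rule arg_cong)
    with True show ?thesis by (simp only: of_real_mult of_real_numeral simp_thms if_True mult_1)
  qed simp
  finally show ?thesis .
qed

lemma L2_inner_powers: "L2_inner (\<lambda>z. z ^ i) (\<lambda>z. z ^ j) = (if i = j then 1 / (of_nat i + 1) else 0)"
proof -
  have "L2_inner (\<lambda>z. z ^ i) (\<lambda>z. z ^ j) = (LINT z|disk_measure. indicator (ball 0 1) z *\<^sub>R (z ^ i * cnj (z ^ j)))"
    unfolding L2_inner_def by (intro Bochner_Integration.integral_cong) auto
  also have "\<dots> = (if i = j then of_real (1 ^ (2 * i + 2) / (i + 1)) else 0)"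
    by (rule monomial_orthogonal) auto
  finally show ?thesis by simp
qed

text \<open>On a disk of radius R < 1 the partial sums are bounded uniformly by \<open>C\<close>, so
  dominated convergence carries the identity for finite sums to the limit.\<close>

lemma parseval_ball:
  fixes a :: "nat \<Rightarrow> complex"
  assumes sums: "\<And>z. z \<in> ball 0 1 \<Longrightarrow> (\<lambda>j. a j * z ^ j) sums u z" and R: "0 \<le> R" "R < 1"
  shows "integrable disk_measure (\<lambda>z. indicator (ball 0 R) z * (cmod (u z))\<^sup>2)"
    and "(\<lambda>j. (cmod (a j))\<^sup>2 * R ^ (2 * j + 2) / (j + 1)) sums
      (LINT z|disk_measure. indicator (ball 0 R) z * (cmod (u z))\<^sup>2)"
proof -
  define s where "s n z = (\<Sum>j<n. a j * z ^ j)" for n z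
  define C where "C = (\<Sum>j. cmod (a j * of_real R ^ j))"
  \<comment> \<open>Convergence at a point beyond R gives absolute convergence at R.\<close>
  define \<rho> where "\<rho> = (1 + R) / 2"
  have \<rho>: "R < \<rho>" "\<rho> < 1" using R by (auto simp: \<rho>_def)
  have "summable (\<lambda>j. a j * of_real \<rho> ^ j)"
    using sums[of "of_real \<rho>"] \<rho> R by (auto simp: sums_iff)
  then have summ: "summable (\<lambda>j. cmod (a j * of_real R ^ j))"
    by (rule powser_insidea) (use \<rho> R in auto)
  have s_bound: "cmod (s n z) \<le> C" if z: "z \<in> ball 0 R" for n z
  proof -
    have "cmod (s n z) \<le> (\<Sum>j<n. cmod (a j * z ^ j))"
      unfolding s_def by (rule norm_sum)
    also have "\<dots> \<le> (\<Sum>j<n. cmod (a j * of_real R ^ j))"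
      using z R by (intro sum_mono) (auto simp: norm_mult norm_power intro!: mult_left_mono power_mono)
    also have "\<dots> \<le> C"
      unfolding C_def by (rule sum_le_suminf[OF summ]) auto
    finally show ?thesis .
  qed
  have ball_sets: "ball 0 R \<in> sets disk_measure"
    using R by (auto simp: sets_disk_measure sets_restrict_space_iff subset_ball)
  have ind [measurable]: "(\<lambda>z. indicator (ball 0 R) z :: real) \<in> borel_measurable disk_measure"
    by (rule borel_measurable_indicator[OF ball_sets])
  have s_meas [measurable]: "s n \<in> borel_measurable disk_measure" for n
    unfolding s_def by (intro continuous_on_measurable_disk continuous_intros)
  have s_lim: "(\<lambda>n. s n z) \<longlonglongrightarrow> u z" if "z \<in> ball 0 1" for z
    using sums[OF that] unfolding sums_def s_def .
  have u_meas [measurable]: "u \<in> borel_measurable disk_measure"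
    by (rule borel_measurable_LIMSEQ_metric[of s, OF s_meas]) (simp add: s_lim)
  have lim: "AE z in disk_measure. (\<lambda>n. indicator (ball 0 R) z * (cmod (s n z))\<^sup>2) \<longlonglongrightarrow> indicator (ball 0 R) z * (cmod (u z))\<^sup>2"
    by (rule AE_I2) (auto intro!: tendsto_intros s_lim)
  have bound: "AE z in disk_measure. norm (indicator (ball 0 R) z * (cmod (s n z))\<^sup>2) \<le> C\<^sup>2" for n
    using s_bound by (auto intro!: AE_I2 power_mono simp: indicator_def)
  show "integrable disk_measure (\<lambda>z. indicator (ball 0 R) z * (cmod (u z))\<^sup>2)"
    by (rule integrable_dominated_convergence[OF _ _ _ lim bound]) measurable
  have conv: "(\<lambda>n. LINT z|disk_measure. indicator (ball 0 R) z * (cmod (s n z))\<^sup>2) \<longlonglongrightarrow>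
      (LINT z|disk_measure. indicator (ball 0 R) z * (cmod (u z))\<^sup>2)"
    by (rule integral_dominated_convergence[OF _ _ _ lim bound]) measurable
  have partial: "(LINT z|disk_measure. indicator (ball 0 R) z * (cmod (s n z))\<^sup>2) =
      (\<Sum>j<n. (cmod (a j))\<^sup>2 * R ^ (2 * j + 2) / (j + 1))" for n
  proof -
    have int: "integrable disk_measure (\<lambda>z. indicator (ball 0 R) z *\<^sub>R (z ^ i * cnj (z ^ j)))" for i j
      by (intro integrable_mult_indicator ball_sets integrable_L2_inner power_in_L2_disk)
    have "complex_of_real (LINT z|disk_measure. indicator (ball 0 R) z * (cmod (s n z))\<^sup>2) =
        (LINT z|disk_measure. complex_of_real (indicator (ball 0 R) z * (cmod (s n z))\<^sup>2))"
      by (rule integral_complex_of_real[symmetric])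
    also have "\<dots> = (LINT z|disk_measure. (\<Sum>i<n. \<Sum>j<n. (a i * cnj (a j)) * (indicator (ball 0 R) z *\<^sub>R (z ^ i * cnj (z ^ j)))))"
    proof (intro Bochner_Integration.integral_cong refl)
      fix z
      have prod: "s n z * cnj (s n z) = (\<Sum>i<n. \<Sum>j<n. (a i * z ^ i) * cnj (a j * z ^ j))"
        unfolding s_def cnj_sum by (rule sum_product)
      have "complex_of_real (indicator (ball 0 R) z * (cmod (s n z))\<^sup>2) = of_real (indicator (ball 0 R) z) * (s n z * cnj (s n z))"
        by (simp only: of_real_mult complex_norm_square)
      also have "\<dots> = (\<Sum>i<n. \<Sum>j<n. (a i * cnj (a j)) * (indicator (ball 0 R) z *\<^sub>R (z ^ i * cnj (z ^ j))))"
        unfolding prod sum_distrib_left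
        by (intro sum.cong refl) (simp add: scaleR_conv_of_real mult_ac)
      finally show "complex_of_real (indicator (ball 0 R) z * (cmod (s n z))\<^sup>2) =
         (\<Sum>i<n. \<Sum>j<n. (a i * cnj (a j)) * (indicator (ball 0 R) z *\<^sub>R (z ^ i * cnj (z ^ j))))" .
    qed
    also have "\<dots> = (\<Sum>i<n. \<Sum>j<n. (a i * cnj (a j)) * (LINT z|disk_measure. indicator (ball 0 R) z *\<^sub>R (z ^ i * cnj (z ^ j))))"
      by (subst Bochner_Integration.integral_sum, use int in \<open>force intro!: Bochner_Integration.integrable_sum integrable_mult_right\<close>,
          intro sum.cong refl, subst Bochner_Integration.integral_sum, use int in \<open>force intro!: integrable_mult_right\<close>,
          intro sum.cong refl integral_mult_right_zero)
    also have "\<dots> = (\<Sum>i<n. (a i * cnj (a i)) * of_real (R ^ (2 * i + 2) / (i + 1)))"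
    proof (intro sum.cong refl)
      fix i assume "i \<in> {..<n}"
      then show "(\<Sum>j<n. (a i * cnj (a j)) * (LINT z|disk_measure. indicator (ball 0 R) z *\<^sub>R (z ^ i * cnj (z ^ j)))) =
         (a i * cnj (a i)) * of_real (R ^ (2 * i + 2) / (i + 1))"
        using R by (subst sum.cong[OF refl, of _ _ "\<lambda>j. if j = i then (a i * cnj (a i)) * of_real (R ^ (2 * i + 2) / (i + 1)) else 0"])
          (simp_all only: monomial_orthogonal less_imp_le, auto)
    qed
    also have "\<dots> = complex_of_real (\<Sum>j<n. (cmod (a j))\<^sup>2 * R ^ (2 * j + 2) / (j + 1))"
      unfolding of_real_sum by (intro sum.cong refl) (simp only: complex_norm_square[symmetric] of_real_mult[symmetric] times_divide_eq_right)
    finally show ?thesis by (simp only: of_real_eq_iff)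
  qed
  show "(\<lambda>j. (cmod (a j))\<^sup>2 * R ^ (2 * j + 2) / (j + 1)) sums
      (LINT z|disk_measure. indicator (ball 0 R) z * (cmod (u z))\<^sup>2)"
    using conv unfolding partial sums_def .
qed

text \<open>Both sides of \<open>parseval_ball\<close> increase with R, so monotone convergence lets
  R tend to 1. In the extended nonnegative reals the formula includes infinite norms and hence
  decides membership in \<open>L2_disk\<close>.\<close>

lemma parseval:
  fixes a :: "nat \<Rightarrow> complex"
  assumes sums: "\<And>z. z \<in> ball 0 1 \<Longrightarrow> (\<lambda>j. a j * z ^ j) sums u z"
  shows "(\<integral>\<^sup>+ z. ennreal ((cmod (u z))\<^sup>2) \<partial>disk_measure) = (\<Sum>j. ennreal ((cmod (a j))\<^sup>2 / (j + 1)))"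
proof -
  define R :: "nat \<Rightarrow> real" where "R k = 1 - 1 / (real k + 1)" for k
  have R: "0 \<le> R k" "R k < 1" for k by (auto simp: R_def field_simps)
  have R_mono: "R k \<le> R l" if "k \<le> l" for k l using that by (simp add: R_def frac_le)
  have R_lim: "R \<longlonglongrightarrow> 1" unfolding R_def using tendsto_diff[OF tendsto_const[of 1] LIMSEQ_inverse_real_of_nat]
    by (simp add: divide_inverse add.commute)
  have SUP: "(SUP k. ennreal ((cmod (a j))\<^sup>2 * R k ^ (2 * j + 2) / (j + 1))) = ennreal ((cmod (a j))\<^sup>2 / (j + 1))" for j
  proof (rule LIMSEQ_unique[OF LIMSEQ_SUP])
    show "incseq (\<lambda>k. ennreal ((cmod (a j))\<^sup>2 * R k ^ (2 * j + 2) / (j + 1)))"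
      using R R_mono by (intro incseq_SucI ennreal_leI divide_right_mono mult_left_mono power_mono) auto
    have "(\<lambda>k. (cmod (a j))\<^sup>2 * R k ^ (2 * j + 2) / (j + 1)) \<longlonglongrightarrow> (cmod (a j))\<^sup>2 * 1 ^ (2 * j + 2) / (j + 1)"
      by (intro tendsto_intros R_lim) auto
    then show "(\<lambda>k. ennreal ((cmod (a j))\<^sup>2 * R k ^ (2 * j + 2) / (j + 1))) \<longlonglongrightarrow> ennreal ((cmod (a j))\<^sup>2 / (j + 1))"
      by (intro tendsto_ennrealI) simp
  qed
  let ?f = "\<lambda>k z. ennreal (indicator (ball 0 (R k)) z * (cmod (u z))\<^sup>2)"
  have ind: "indicator (ball 0 (R k)) z \<le> (indicator (ball 0 (R (Suc k))) z :: real)" for k and z :: complex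
    using R_mono[of k "Suc k"] by (auto simp: indicator_def)
  have "(\<integral>\<^sup>+ z. ennreal ((cmod (u z))\<^sup>2) \<partial>disk_measure) = (\<integral>\<^sup>+ z. (SUP k. ?f k z) \<partial>disk_measure)"
  proof (rule nn_integral_cong)
    fix z assume "z \<in> space disk_measure"
    then have "eventually (\<lambda>k. cmod z < R k) sequentially"
      using order_tendstoD(1)[OF R_lim, of "cmod z"] by simp
    then have "eventually (\<lambda>k. ?f k z = ennreal ((cmod (u z))\<^sup>2)) sequentially"
      by eventually_elim simp
    then have "(\<lambda>k. ?f k z) \<longlonglongrightarrow> ennreal ((cmod (u z))\<^sup>2)"
      by (rule tendsto_eventually)
    moreover have "incseq (\<lambda>k. ?f k z)"
      by (intro incseq_SucI ennreal_leI mult_right_mono ind) auto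
    ultimately show "ennreal ((cmod (u z))\<^sup>2) = (SUP k. ?f k z)"
      using LIMSEQ_unique LIMSEQ_SUP by blast
  qed
  also have "\<dots> = (SUP k. \<integral>\<^sup>+ z. ?f k z \<partial>disk_measure)"
  proof (rule nn_integral_monotone_convergence_SUP)
    show "incseq ?f"
      by (intro incseq_SucI le_funI ennreal_leI mult_right_mono ind) auto
    show "?f k \<in> borel_measurable disk_measure" for k
      using borel_measurable_integrable[OF parseval_ball(1)[OF sums R]] by auto
  qed
  also have "\<dots> = (SUP k. \<Sum>j. ennreal ((cmod (a j))\<^sup>2 * R k ^ (2 * j + 2) / (j + 1)))"
  proof (intro SUP_cong refl)
    fix k
    have "(\<integral>\<^sup>+ z. ?f k z \<partial>disk_measure) = ennreal (LINT z|disk_measure. indicator (ball 0 (R k)) z * (cmod (u z))\<^sup>2)"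
      by (intro nn_integral_eq_integral parseval_ball(1)[OF sums R]) auto
    also have "\<dots> = (\<Sum>j. ennreal ((cmod (a j))\<^sup>2 * R k ^ (2 * j + 2) / (j + 1)))"
      by (rule suminf_ennreal_eq[symmetric, OF _ parseval_ball(2)[OF sums R]]) (use R in auto)
    finally show "(\<integral>\<^sup>+ z. ?f k z \<partial>disk_measure) = (\<Sum>j. ennreal ((cmod (a j))\<^sup>2 * R k ^ (2 * j + 2) / (j + 1)))" .
  qed
  also have "\<dots> = (\<Sum>j. SUP k. ennreal ((cmod (a j))\<^sup>2 * R k ^ (2 * j + 2) / (j + 1)))"
    using R R_mono
    by (intro ennreal_suminf_SUP_eq[symmetric] incseq_SucI ennreal_leI divide_right_mono mult_left_mono power_mono) auto
  finally show ?thesis by (simp only: SUP)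
qed

lemma nn_integral_L2_disk:
  assumes "u \<in> L2_disk"
  shows "(\<integral>\<^sup>+ z. ennreal ((cmod (u z))\<^sup>2) \<partial>disk_measure) = ennreal (LINT z|disk_measure. (cmod (u z))\<^sup>2)"
  using L2_diskD[OF assms] by (intro nn_integral_eq_integral) auto

lemma L2_disk_power_series:
  assumes sums: "\<And>z. z \<in> ball 0 1 \<Longrightarrow> (\<lambda>j. a j * z ^ j) sums u z"
  shows "u \<in> L2_disk \<longleftrightarrow> summable (\<lambda>j. (cmod (a j))\<^sup>2 / (j + 1))"
    and "u \<in> L2_disk \<Longrightarrow> (LINT z|disk_measure. (cmod (u z))\<^sup>2) = (\<Sum>j. (cmod (a j))\<^sup>2 / (j + 1))"
proof -
  have meas [measurable]: "u \<in> borel_measurable disk_measure"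
  proof (rule borel_measurable_LIMSEQ_metric)
    show "(\<lambda>z. \<Sum>j<n. a j * z ^ j) \<in> borel_measurable disk_measure" for n
      by (intro continuous_on_measurable_disk continuous_intros)
    show "(\<lambda>n. \<Sum>j<n. a j * z ^ j) \<longlonglongrightarrow> u z" if "z \<in> space disk_measure" for z
      using sums[of z] that by (simp add: sums_def)
  qed
  show iff: "u \<in> L2_disk \<longleftrightarrow> summable (\<lambda>j. (cmod (a j))\<^sup>2 / (j + 1))"
  proof
    assume u: "u \<in> L2_disk"
    have "(\<Sum>j. ennreal ((cmod (a j))\<^sup>2 / (j + 1))) = ennreal (LINT z|disk_measure. (cmod (u z))\<^sup>2)"
      using parseval[OF sums] nn_integral_L2_disk[OF u] by (rule trans[OF sym])
    then have "(\<Sum>j. ennreal ((cmod (a j))\<^sup>2 / (j + 1))) \<noteq> top_class.top"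
      by (metis ennreal_neq_top)
    then show "summable (\<lambda>j. (cmod (a j))\<^sup>2 / (j + 1))"
      by (intro summable_suminf_not_top) auto
  next
    assume "summable (\<lambda>j. (cmod (a j))\<^sup>2 / (j + 1))"
    then have sum_eq: "(\<Sum>j. ennreal ((cmod (a j))\<^sup>2 / (j + 1))) = ennreal (\<Sum>j. (cmod (a j))\<^sup>2 / (j + 1))"
      by (intro suminf_ennreal2) auto
    have "(\<integral>\<^sup>+ z. ennreal ((cmod (u z))\<^sup>2) \<partial>disk_measure) = ennreal (\<Sum>j. (cmod (a j))\<^sup>2 / (j + 1))"
      by (rule trans[OF parseval[OF sums] sum_eq])
    then have "integrable disk_measure (\<lambda>z. (cmod (u z))\<^sup>2)"
      by (intro integrableI_bounded) auto
    then show "u \<in> L2_disk" by (simp add: L2_disk_def meas)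
  qed
  assume u: "u \<in> L2_disk"
  then have summ: "summable (\<lambda>j. (cmod (a j))\<^sup>2 / (j + 1))" using iff by simp
  have sum_eq: "(\<Sum>j. ennreal ((cmod (a j))\<^sup>2 / (j + 1))) = ennreal (\<Sum>j. (cmod (a j))\<^sup>2 / (j + 1))"
    using summ by (intro suminf_ennreal2) auto
  have "ennreal (LINT z|disk_measure. (cmod (u z))\<^sup>2) = ennreal (\<Sum>j. (cmod (a j))\<^sup>2 / (j + 1))"
    by (rule trans[OF nn_integral_L2_disk[OF u, symmetric] trans[OF parseval[OF sums] sum_eq]])
  then show "(LINT z|disk_measure. (cmod (u z))\<^sup>2) = (\<Sum>j. (cmod (a j))\<^sup>2 / (j + 1))"
    using summ by (subst (asm) ennreal_inj) (auto intro!: suminf_nonneg)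
qed

text \<open>The Taylor polynomials of \<open>v\<close> converge to \<open>v\<close> in norm, since
  by Parseval the squared distance is the tail of a convergent series, and the inner product is
  continuous under such limits.\<close>

lemma L2_inner_power_series:
  assumes sums: "\<And>z. z \<in> ball 0 1 \<Longrightarrow> (\<lambda>j. a j * z ^ j) sums v z"
    and v: "v \<in> L2_disk" and u: "u \<in> L2_disk"
  shows "(\<lambda>j. cnj (a j) * L2_inner u (\<lambda>z. z ^ j)) sums L2_inner u v"
proof -
  define s where "s n z = (\<Sum>j<n. a j * z ^ j)" for n z
  have s: "s n \<in> L2_disk" for n
    unfolding s_def by (intro L2_disk_sum L2_disk_cmult power_in_L2_disk)
  have summ: "summable (\<lambda>j. (cmod (a j))\<^sup>2 / (j + 1))"
    using L2_disk_power_series(1)[OF sums] v by simp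
  have tail: "(LINT z|disk_measure. (cmod (v z - s n z))\<^sup>2) =
      (\<Sum>j. (cmod (a j))\<^sup>2 / (j + 1)) - (\<Sum>j<n. (cmod (a j))\<^sup>2 / (j + 1))" for n
  proof -
    \<comment> \<open>Deleting the first n coefficients turns the remainder into a power series of
      its own, to which Parseval's formula applies.\<close>
    define b where "b j = (if j < n then 0 else a j)" for j
    have "(\<lambda>j. b j * z ^ j) sums (v z - s n z)" if "z \<in> ball 0 1" for z
    proof -
      have "(\<lambda>j. a j * z ^ j - (if j \<in> {..<n} then a j * z ^ j else 0)) sums (v z - (\<Sum>j\<in>{..<n}. a j * z ^ j))"
        by (intro sums_diff sums[OF that] sums_If_finite_set) auto
      moreover have "(\<lambda>j. a j * z ^ j - (if j \<in> {..<n} then a j * z ^ j else 0)) = (\<lambda>j. b j * z ^ j)"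
        by (auto simp: b_def)
      ultimately show ?thesis by (simp add: s_def)
    qed
    from L2_disk_power_series(2)[OF this] have
      "(LINT z|disk_measure. (cmod (v z - s n z))\<^sup>2) = (\<Sum>j. (cmod (b j))\<^sup>2 / (j + 1))"
      using v s by (simp add: L2_disk_diff)
    also have "(\<lambda>j. (cmod (b j))\<^sup>2 / (j + 1)) = (\<lambda>j. (cmod (a j))\<^sup>2 / (j + 1) - (if j \<in> {..<n} then (cmod (a j))\<^sup>2 / (j + 1) else 0))"
      by (auto simp: b_def)
    also have "(\<Sum>j. (cmod (a j))\<^sup>2 / (j + 1) - (if j \<in> {..<n} then (cmod (a j))\<^sup>2 / (j + 1) else 0)) =
       (\<Sum>j. (cmod (a j))\<^sup>2 / (j + 1)) - (\<Sum>j\<in>{..<n}. (cmod (a j))\<^sup>2 / (j + 1))"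
      by (intro sums_unique[symmetric] sums_diff summable_sums summ sums_If_finite_set) auto
    finally show ?thesis by simp
  qed
  have "(\<lambda>n. (\<Sum>j. (cmod (a j))\<^sup>2 / (j + 1)) - (\<Sum>j<n. (cmod (a j))\<^sup>2 / (j + 1))) \<longlonglongrightarrow>
      (\<Sum>j. (cmod (a j))\<^sup>2 / (j + 1)) - (\<Sum>j. (cmod (a j))\<^sup>2 / (j + 1))"
    by (intro tendsto_diff tendsto_const summable_LIMSEQ summ)
  then have "(\<lambda>n. L2_inner u (s n)) \<longlonglongrightarrow> L2_inner u v"
    by (intro L2_inner_tendsto u v s) (simp add: tail)
  moreover have "L2_inner u (s n) = (\<Sum>j<n. cnj (a j) * L2_inner u (\<lambda>z. z ^ j))" for n
    unfolding s_def by (subst L2_inner_sum_right) (auto intro: L2_disk_cmult power_in_L2_disk u simp: L2_inner_cmult_right)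
  ultimately show ?thesis by (simp add: sums_def)
qed

lemma L2_inner_power_series_coeff:
  assumes sums: "\<And>z. z \<in> ball 0 1 \<Longrightarrow> (\<lambda>j. a j * z ^ j) sums v z" and v: "v \<in> L2_disk"
  shows "L2_inner v (\<lambda>z. z ^ i) = a i / (of_nat i + 1)"
proof -
  have "(\<lambda>j. cnj (a j) * L2_inner (\<lambda>z. z ^ i) (\<lambda>z. z ^ j)) sums L2_inner (\<lambda>z. z ^ i) v"
    by (rule L2_inner_power_series[OF sums v power_in_L2_disk])
  moreover have "(\<lambda>j. cnj (a j) * L2_inner (\<lambda>z. z ^ i) (\<lambda>z. z ^ j)) sums (cnj (a i) / (of_nat i + 1))"
    using sums_single[of i "\<lambda>j. cnj (a j) / (of_nat i + 1)"]
    by (rule sums_cong[THEN iffD1, rotated]) (auto simp: L2_inner_powers)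
  ultimately have "L2_inner (\<lambda>z. z ^ i) v = cnj (a i) / (of_nat i + 1)"
    by (rule sums_unique2)
  then show ?thesis by (subst L2_inner_commute) simp
qed

section \<open>Existence of the projection and its description by moments\<close>

lemma bergman_spaceD:
  assumes "u \<in> bergman_space"
  shows "u \<in> L2_disk" "u holomorphic_on ball 0 1" "z \<notin> ball 0 1 \<Longrightarrow> u z = 0"
  using assms by (auto simp: bergman_space_def)

lemma bergman_space_power_series:
  assumes "u \<in> bergman_space" "z \<in> ball 0 1"
  shows "(\<lambda>j. (deriv ^^ j) u 0 / fact j * z ^ j) sums u z"
  using holomorphic_power_series[OF bergman_spaceD(2)[OF assms(1)] assms(2)] by simp

text \<open>Up to a factor j + 1 the moments are the Taylor coefficients, and off the disk both
  functions are 0.\<close>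

lemma bergman_space_eqI:
  assumes u: "u \<in> bergman_space" and v: "v \<in> bergman_space"
    and eq: "\<And>j. L2_inner u (\<lambda>z. z ^ j) = L2_inner v (\<lambda>z. z ^ j)"
  shows "u = v"
proof
  fix z
  have "(deriv ^^ j) u 0 / fact j = (deriv ^^ j) v 0 / fact j" for j
  proof -
    have "of_nat j + 1 \<noteq> (0 :: complex)" by (rule of_nat_add_1_neq_0)
    then show ?thesis
      using eq[of j] L2_inner_power_series_coeff[OF bergman_space_power_series[OF u] bergman_spaceD(1)[OF u], of j]
        L2_inner_power_series_coeff[OF bergman_space_power_series[OF v] bergman_spaceD(1)[OF v], of j]
      by simp
  qed
  then show "u z = v z"
    using bergman_space_power_series[OF u, of z] bergman_space_power_series[OF v, of z]
      bergman_spaceD(3)[OF u] bergman_spaceD(3)[OF v]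
    by (cases "z \<in> ball 0 1") (simp_all add: sums_unique2)
qed

text \<open>Bessel's inequality for the orthonormal functions sqrt(j + 1) z^j: \<open>s\<close> is
  the projection of \<open>h\<close> to the polynomials of degree below n, and the difference of the
  two sides is the squared norm of h - s.\<close>

lemma L2_disk_bessel:
  assumes h: "h \<in> L2_disk"
  shows "(\<Sum>j<n. (real j + 1) * (cmod (L2_inner h (\<lambda>z. z ^ j)))\<^sup>2) \<le> (LINT z|disk_measure. (cmod (h z))\<^sup>2)"
proof -
  define c where "c j = L2_inner h (\<lambda>z. z ^ j)" for j
  define s where "s z = (\<Sum>j<n. ((of_nat j + 1) * c j) * z ^ j)" for z
  define S where "S = (\<Sum>j<n. (real j + 1) * (cmod (c j))\<^sup>2)"
  have s: "s \<in> L2_disk"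
    unfolding s_def[abs_def] by (intro L2_disk_sum L2_disk_cmult power_in_L2_disk)
  have hs: "L2_inner h s = of_real S"
  proof -
    have "L2_inner h s = (\<Sum>j<n. cnj ((of_nat j + 1) * c j) * c j)"
      unfolding s_def[abs_def] c_def using h
      by (subst L2_inner_sum_right) (auto intro: L2_disk_cmult power_in_L2_disk simp: L2_inner_cmult_right)
    also have "\<dots> = of_real S"
      unfolding S_def of_real_sum
      by (intro sum.cong refl) (simp add: complex_norm_square mult_ac del: of_real_power)
    finally show ?thesis .
  qed
  have ps: "L2_inner (\<lambda>z. z ^ i) s = cnj (c i)" if "i < n" for i
  proof -
    have "L2_inner (\<lambda>z. z ^ i) s = (\<Sum>j<n. cnj ((of_nat j + 1) * c j) * L2_inner (\<lambda>z. z ^ i) (\<lambda>z. z ^ j))"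
      unfolding s_def[abs_def]
      by (subst L2_inner_sum_right) (auto intro: L2_disk_cmult power_in_L2_disk simp: L2_inner_cmult_right)
    also have "\<dots> = (\<Sum>j<n. if j = i then cnj (c i) else 0)"
    proof (intro sum.cong refl)
      fix j
      have "of_nat j + 1 \<noteq> (0 :: complex)" by (rule of_nat_add_1_neq_0)
      then show "cnj ((of_nat j + 1) * c j) * L2_inner (\<lambda>z. z ^ i) (\<lambda>z. z ^ j) = (if j = i then cnj (c i) else 0)"
        by (auto simp: L2_inner_powers)
    qed
    finally show ?thesis using that by simp
  qed
  have ss: "L2_inner s s = of_real S"
  proof -
    have "L2_inner s s = (\<Sum>j<n. (of_nat j + 1) * c j * L2_inner (\<lambda>z. z ^ j) s)"
      using s by (subst (1) s_def[abs_def], subst L2_inner_sum_left)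
        (auto intro: L2_disk_cmult power_in_L2_disk simp: L2_inner_cmult_left)
    also have "\<dots> = of_real S"
      unfolding S_def of_real_sum
      by (intro sum.cong refl) (simp add: complex_norm_square ps mult_ac del: of_real_power)
    finally show ?thesis .
  qed
  have "L2_inner (\<lambda>z. h z - s z) (\<lambda>z. h z - s z) = L2_inner h h - of_real S"
    using h s hs ss L2_inner_commute[of s h] by (simp add: L2_inner_diff_left L2_inner_diff_right L2_disk_diff)
  then have "of_real (LINT z|disk_measure. (cmod (h z - s z))\<^sup>2) = complex_of_real ((LINT z|disk_measure. (cmod (h z))\<^sup>2) - S)"
    by (simp add: L2_inner_self del: of_real_diff) (simp only: of_real_diff)
  then have "(LINT z|disk_measure. (cmod (h z - s z))\<^sup>2) = (LINT z|disk_measure. (cmod (h z))\<^sup>2) - S"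
    by (simp only: of_real_eq_iff)
  moreover have "(LINT z|disk_measure. (cmod (h z - s z))\<^sup>2) \<ge> 0" by simp
  ultimately show ?thesis by (simp add: S_def c_def)
qed

text \<open>The moments of \<open>h\<close> dictate the Taylor coefficients of its projection.
  Bessel's inequality makes the resulting power series converge in the disk and its sum square
  integrable.\<close>

lemma bergman_proj_ex:
  assumes h: "h \<in> L2_disk"
  shows "\<exists>u\<in>bergman_space. \<forall>j. L2_inner u (\<lambda>z. z ^ j) = L2_inner h (\<lambda>z. z ^ j)"
proof -
  define c where "c j = L2_inner h (\<lambda>z. z ^ j)" for j
  define a where "a j = (of_nat j + 1) * c j" for j
  define H where "H = (LINT z|disk_measure. (cmod (h z))\<^sup>2)"
  have nz: "of_nat j + 1 \<noteq> (0 :: complex)" for j by (rule of_nat_add_1_neq_0)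
  have norm_a: "cmod (a j) = (real j + 1) * cmod (c j)" for j
    unfolding a_def norm_mult by (metis norm_of_nat of_nat_Suc add.commute)
  have term_eq: "(cmod (a j))\<^sup>2 / (j + 1) = (real j + 1) * (cmod (c j))\<^sup>2" for j
    unfolding norm_a by (simp add: power2_eq_square field_simps)
  have bessel: "(\<Sum>j<n. (cmod (a j))\<^sup>2 / (j + 1)) \<le> H" for n
    using L2_disk_bessel[OF h, of n] unfolding term_eq by (simp add: c_def H_def)
  have summ: "summable (\<lambda>j. (cmod (a j))\<^sup>2 / (j + 1))"
    by (intro summableI_nonneg_bounded[of _ H] bessel) auto
  have H: "H \<ge> 0" by (simp add: H_def)
  \<comment> \<open>Linear growth is enough for comparison with the series of (j + 1) |z|^j. Taking
    \<open>H + 1\<close> makes the bound on the square at most the square of the stated bound, so no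
    root is taken.\<close>
  have bound: "cmod (a j) \<le> (real j + 1) * (H + 1)" for j
  proof -
    have "(cmod (a j))\<^sup>2 / (j + 1) \<le> (\<Sum>i<Suc j. (cmod (a i))\<^sup>2 / (i + 1))"
      by (rule member_le_sum) auto
    also have "\<dots> \<le> H" by (rule bessel)
    finally have "(cmod (a j))\<^sup>2 \<le> (real j + 1) * H" by (simp add: field_simps)
    also have "\<dots> \<le> ((real j + 1) * (H + 1))\<^sup>2"
      using H by (auto simp: power2_eq_square algebra_simps intro!: add_nonneg_nonneg mult_nonneg_nonneg)
    finally show ?thesis by (rule power2_le_imp_le) (use H in auto)
  qed
  have sums: "(\<lambda>j. a j * z ^ j) sums (\<Sum>j. a j * z ^ j)" if z: "z \<in> ball 0 1" for z
  proof (rule summable_sums, rule summable_comparison_test)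
    have "summable (\<lambda>j. of_nat (Suc j) * (of_real (cmod z) ^ j :: real))"
      using z by (intro sums_summable[OF geometric_deriv_sums]) auto
    then show "summable (\<lambda>j. (H + 1) * ((real j + 1) * cmod z ^ j))"
      by (intro summable_mult) (simp add: add.commute)
    show "\<exists>N. \<forall>j\<ge>N. norm (a j * z ^ j) \<le> (H + 1) * ((real j + 1) * cmod z ^ j)"
      using bound by (auto simp: norm_mult norm_power mult_ac intro!: exI[of _ 0] mult_left_mono)
        (metis mult.commute mult.left_commute mult_right_mono norm_ge_zero zero_le_power)
  qed
  define u where "u z = (if z \<in> ball 0 1 then (\<Sum>j. a j * z ^ j) else 0)" for z
  have u_sums: "(\<lambda>j. a j * z ^ j) sums u z" if "z \<in> ball 0 1" for z
    using sums[OF that] that by (simp add: u_def)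
  have "u \<in> L2_disk" using L2_disk_power_series(1)[OF u_sums] summ by simp
  moreover have "u holomorphic_on ball 0 1"
    by (rule power_series_holomorphic[of 0 1 a]) (use u_sums in simp)
  ultimately have u: "u \<in> bergman_space"
    by (auto simp: bergman_space_def u_def)
  have "L2_inner u (\<lambda>z. z ^ j) = c j" for j
    using L2_inner_power_series_coeff[OF u_sums bergman_spaceD(1)[OF u], of j] nz[of j] by (simp add: a_def)
  with u show ?thesis by (auto simp: c_def)
qed

lemma L2_inner_bergman_eq_0:
  assumes w: "w \<in> L2_disk" "\<And>j. L2_inner w (\<lambda>z. z ^ j) = 0" and v: "v \<in> bergman_space"
  shows "L2_inner w v = 0"
  using L2_inner_power_series[OF bergman_space_power_series[OF v] bergman_spaceD(1)[OF v] w(1)]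
  by (simp add: w(2) sums_iff)

lemma restrict_power_in_bergman_space: "(\<lambda>z. if z \<in> ball 0 1 then z ^ j else 0) \<in> bergman_space"
proof -
  have "(\<lambda>z. if z \<in> ball 0 1 then z ^ j else 0) holomorphic_on ball 0 1"
    by (rule holomorphic_transform[of "\<lambda>z. z ^ j"]) (auto intro!: holomorphic_intros)
  then show ?thesis
    using L2_disk_cong[OF power_in_L2_disk[of j]] by (auto simp: bergman_space_def)
qed

text \<open>Orthogonality of h - u to the monomials already gives orthogonality to the whole Bergman
  space, by \<open>L2_inner_bergman_eq_0\<close>. From here on the definite description is handled
  only through moments.\<close>

lemma bergman_proj_iff:
  assumes h: "h \<in> L2_disk"
  shows "bergman_proj h = u \<longleftrightarrow> u \<in> bergman_space \<and> (\<forall>j. L2_inner u (\<lambda>z. z ^ j) = L2_inner h (\<lambda>z. z ^ j))"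
proof -
  have char: "u \<in> bergman_space \<and> (\<forall>v\<in>bergman_space. L2_inner (\<lambda>z. h z - u z) v = 0) \<longleftrightarrow>
     u \<in> bergman_space \<and> (\<forall>j. L2_inner u (\<lambda>z. z ^ j) = L2_inner h (\<lambda>z. z ^ j))" for u
  proof (cases "u \<in> bergman_space")
    case True
    then have uL: "u \<in> L2_disk" by (rule bergman_spaceD)
    have diff: "L2_inner (\<lambda>z. h z - u z) (\<lambda>z. z ^ j) = L2_inner h (\<lambda>z. z ^ j) - L2_inner u (\<lambda>z. z ^ j)" for j
      by (rule L2_inner_diff_left[OF h uL power_in_L2_disk])
    \<comment> \<open>Only the monomial cut off outside the disk lies in
      \<open>bergman_space\<close>; the inner product does not see the difference.\<close>
    have restr: "L2_inner (\<lambda>z. h z - u z) (\<lambda>z. if z \<in> ball 0 1 then z ^ j else 0) = L2_inner (\<lambda>z. h z - u z) (\<lambda>z. z ^ j)" for j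
      by (rule L2_inner_cong) auto
    have "(\<forall>v\<in>bergman_space. L2_inner (\<lambda>z. h z - u z) v = 0) \<longleftrightarrow> (\<forall>j. L2_inner (\<lambda>z. h z - u z) (\<lambda>z. z ^ j) = 0)"
    proof (intro iffI allI ballI)
      fix j assume "\<forall>v\<in>bergman_space. L2_inner (\<lambda>z. h z - u z) v = 0"
      from bspec[OF this restrict_power_in_bergman_space[of j]]
      show "L2_inner (\<lambda>z. h z - u z) (\<lambda>z. z ^ j) = 0" by (simp only: restr)
    next
      fix v assume "\<forall>j. L2_inner (\<lambda>z. h z - u z) (\<lambda>z. z ^ j) = 0" "v \<in> bergman_space"
      then show "L2_inner (\<lambda>z. h z - u z) v = 0"
        using L2_inner_bergman_eq_0[OF L2_disk_diff[OF h uL]] by blast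
    qed
    also have "\<dots> \<longleftrightarrow> (\<forall>j. L2_inner u (\<lambda>z. z ^ j) = L2_inner h (\<lambda>z. z ^ j))"
      unfolding diff by auto
    finally show ?thesis using True by blast
  qed simp
  obtain u0 where u0: "u0 \<in> bergman_space" "\<And>j. L2_inner u0 (\<lambda>z. z ^ j) = L2_inner h (\<lambda>z. z ^ j)"
    using bergman_proj_ex[OF h] by blast
  have "bergman_proj h = u0"
    unfolding bergman_proj_def char using u0 by (intro the_equality) (auto intro: bergman_space_eqI)
  then show ?thesis using u0 by (auto intro: bergman_space_eqI)
qed

section \<open>Reduction to a single Toeplitz operator\<close>

lemma bergman_space_add: "u \<in> bergman_space \<Longrightarrow> v \<in> bergman_space \<Longrightarrow> (\<lambda>z. u z + v z) \<in> bergman_space"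
  by (auto simp: bergman_space_def intro: L2_disk_add holomorphic_intros)

lemma bergman_space_cmult: "u \<in> bergman_space \<Longrightarrow> (\<lambda>z. c * u z) \<in> bergman_space"
  by (auto simp: bergman_space_def intro: L2_disk_cmult holomorphic_intros)

lemma toeplitz_poly_iff:
  assumes g: "g \<in> L2_disk"
  shows "toeplitz g (poly p) = u \<longleftrightarrow>
    u \<in> bergman_space \<and> (\<forall>j. L2_inner u (\<lambda>z. z ^ j) = L2_inner (\<lambda>z. g z * poly p z) (\<lambda>z. z ^ j))"
  unfolding toeplitz_def by (rule bergman_proj_iff[OF L2_disk_poly_mult[OF g]])

lemma toeplitz_poly:
  assumes "g \<in> L2_disk"
  shows "toeplitz g (poly p) \<in> bergman_space"
    and "L2_inner (toeplitz g (poly p)) (\<lambda>z. z ^ j) = L2_inner (\<lambda>z. g z * poly p z) (\<lambda>z. z ^ j)"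
  using toeplitz_poly_iff[OF assms, of p "toeplitz g (poly p)"] by auto

text \<open>The output of the first Toeplitz operator is 0 off the disk, hence not literally a
  polynomial function; this lets the second operator treat it as one.\<close>

lemma toeplitz_cong_disk:
  assumes g: "g \<in> L2_disk" and \<phi>: "\<And>z. z \<in> ball 0 1 \<Longrightarrow> \<phi> z = poly p z"
  shows "toeplitz g \<phi> = toeplitz g (poly p)"
proof -
  have L: "(\<lambda>z. g z * \<phi> z) \<in> L2_disk"
    by (rule L2_disk_cong[OF L2_disk_poly_mult[OF g, of p]]) (simp add: \<phi>)
  have "L2_inner (\<lambda>z. g z * \<phi> z) v = L2_inner (\<lambda>z. g z * poly p z) v" for v
    by (rule L2_inner_cong) (simp_all add: \<phi>)
  then show ?thesis
    using toeplitz_poly[OF g, of p] by (subst toeplitz_def, subst bergman_proj_iff[OF L]) simp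
qed

lemma toeplitz_poly_add:
  assumes g: "g \<in> L2_disk"
  shows "toeplitz g (poly (p + q)) = toeplitz g (poly p) + toeplitz g (poly q)"
proof -
  have "(\<lambda>z. g z * poly (p + q) z) = (\<lambda>z. g z * poly p z + g z * poly q z)"
    by (simp add: algebra_simps)
  then show ?thesis
    unfolding toeplitz_poly_iff[OF g] plus_fun_def
    by (simp add: bergman_space_add toeplitz_poly[OF g] L2_inner_add_left L2_disk_poly_mult[OF g]
      power_in_L2_disk bergman_spaceD(1)[OF toeplitz_poly(1)[OF g]])
qed

lemma toeplitz_poly_smult:
  assumes g: "g \<in> L2_disk"
  shows "toeplitz g (poly (Polynomial.smult c p)) = (\<lambda>z. c * toeplitz g (poly p) z)"
proof -
  have "(\<lambda>z. g z * poly (Polynomial.smult c p) z) = (\<lambda>z. c * (g z * poly p z))"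
    by (simp add: algebra_simps)
  then show ?thesis
    unfolding toeplitz_poly_iff[OF g]
    by (simp add: bergman_space_cmult toeplitz_poly[OF g] L2_inner_cmult_left)
qed

lemma toeplitz_poly_0:
  assumes g: "g \<in> L2_disk"
  shows "toeplitz g (poly 0) = 0"
  using toeplitz_poly_smult[OF g, of 0 0] by (simp add: zero_fun_def)

text \<open>In polar coordinates z^n conj(z^j) is r^(n + j) times an exponential that selects the
  angular coefficient of index j - n; the remaining power of r is the Jacobian.\<close>

lemma L2_inner_moment:
  assumes f: "f \<in> L2_disk"
  shows "L2_inner (\<lambda>z. f z * z ^ n) (\<lambda>z. z ^ j) =
    2 * (LINT r|lebesgue_on {0..<1}. angular_coeff f (int j - int n) r * of_real (r ^ (n + j + 1)))"
proof -
  have "(\<lambda>z. f z * z ^ n) \<in> L2_disk"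
    using L2_disk_poly_mult[OF f, of "monom 1 n"] by (simp add: poly_monom)
  then have "integrable disk_measure (\<lambda>z. f z * z ^ n * cnj (z ^ j))"
    by (rule integrable_L2_inner[OF _ power_in_L2_disk])
  note integral_disk_polar[OF this]
  also have "(LINT r|lebesgue_on {0..<1}. 1 / (2 * pi) * (LINT t|lebesgue_on {0..2 * pi}.
        f (rcis r t) * rcis r t ^ n * cnj (rcis r t ^ j)) * of_real r) =
      (LINT r|lebesgue_on {0..<1}. angular_coeff f (int j - int n) r * of_real (r ^ (n + j + 1)))"
  proof (intro Bochner_Integration.integral_cong refl)
    fix r :: real
    have "f (rcis r t) * rcis r t ^ n * cnj (rcis r t ^ j) =
        of_real (r ^ (n + j)) * (f (rcis r t) * exp (- \<i> * of_int (int j - int n) * of_real t))" for t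
    proof -
      have "cis t ^ n * cnj (cis t ^ j) = cis (- (of_int (int j - int n) * t))"
        by (simp add: Complex.DeMoivre cis_cnj cis_mult algebra_simps)
      also have "\<dots> = exp (- \<i> * of_int (int j - int n) * of_real t)"
        unfolding cis_conv_exp by (rule arg_cong[of _ _ exp]) simp
      finally have "cis t ^ n * cnj (cis t ^ j) = exp (- \<i> * of_int (int j - int n) * of_real t)" .
      moreover have "rcis r t ^ n * cnj (rcis r t ^ j) = of_real (r ^ (n + j)) * (cis t ^ n * cnj (cis t ^ j))"
        by (simp add: rcis_def power_mult_distrib power_add)
      ultimately show ?thesis
        by (simp only: mult.assoc) (simp only: mult.left_commute)
    qed
    then show "1 / (2 * pi) * (LINT t|lebesgue_on {0..2 * pi}.
        f (rcis r t) * rcis r t ^ n * cnj (rcis r t ^ j)) * of_real r =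
        angular_coeff f (int j - int n) r * of_real (r ^ (n + j + 1))"
      unfolding angular_coeff_def by (simp only: integral_mult_right_zero) (simp add: mult_ac)
  qed
  finally show ?thesis unfolding L2_inner_def .
qed

lemma restrict_poly_in_bergman_space: "(\<lambda>z. if z \<in> ball 0 1 then poly p z else 0) \<in> bergman_space"
proof -
  have "(\<lambda>z. if z \<in> ball 0 1 then poly p z else 0) holomorphic_on ball 0 1"
    by (rule holomorphic_transform[of "poly p"]) (auto intro!: holomorphic_intros)
  moreover have "(\<lambda>z. if z \<in> ball 0 1 then poly p z else 0) \<in> L2_disk"
  proof (rule L2_disk_cong)
    have "(\<lambda>_. 1) \<in> L2_disk" using power_in_L2_disk[of 0] by simp
    then show "(\<lambda>z. 1 * poly p z) \<in> L2_disk" by (rule L2_disk_poly_mult)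
  qed simp
  ultimately show ?thesis by (simp add: bergman_space_def)
qed

lemma L2_inner_restrict_poly:
  "L2_inner (\<lambda>z. if z \<in> ball 0 1 then poly p z else 0) (\<lambda>z. z ^ j) = coeff p j / (of_nat j + 1)"
proof (rule L2_inner_power_series_coeff)
  fix z :: complex assume z: "z \<in> ball 0 1"
  have "(\<lambda>j. coeff p j * z ^ j) sums (\<Sum>j\<le>degree p. coeff p j * z ^ j)"
    by (rule sums_finite) (auto simp: not_le coeff_eq_0)
  then show "(\<lambda>j. coeff p j * z ^ j) sums (if z \<in> ball 0 1 then poly p z else 0)"
    using z by (simp add: poly_altdef)
qed (rule bergman_spaceD(1)[OF restrict_poly_in_bergman_space])

text \<open>An element of the Bergman space with finitely many nonzero moments is a polynomial on
  the disk, and here the moment of index i vanishes for i > n + M.\<close>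

lemma toeplitz_monom:
  fixes M :: int
  assumes f: "f \<in> L2_disk"
    and M: "\<And>m::int. m > M \<Longrightarrow> AE r in lebesgue_on {0..<1}. angular_coeff f m r = 0"
  shows "\<exists>t. toeplitz f (poly (monom 1 n)) = (\<lambda>z. if z \<in> ball 0 1 then poly t z else 0) \<and>
    (\<forall>i. coeff t i = 2 * (of_nat i + 1) *
      (LINT r|lebesgue_on {0..<1}. angular_coeff f (int i - int n) r * of_real (r ^ (n + i + 1)))) \<and>
    (\<forall>i. int i > int n + M \<longrightarrow> coeff t i = 0)"
proof -
  define c where "c i = L2_inner (\<lambda>z. f z * z ^ n) (\<lambda>z. z ^ i)" for i
  have c: "c i = 2 * (LINT r|lebesgue_on {0..<1}. angular_coeff f (int i - int n) r * of_real (r ^ (n + i + 1)))" for i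
    unfolding c_def by (rule L2_inner_moment[OF f])
  have c0: "c i = 0" if "int i > int n + M" for i
  proof -
    have "AE r in lebesgue_on {0..<1}. angular_coeff f (int i - int n) r = 0"
      using that by (intro M) auto
    then have "AE r in lebesgue_on {0..<1}. angular_coeff f (int i - int n) r * of_real (r ^ (n + i + 1)) = 0"
      by eventually_elim simp
    then have "(LINT r|lebesgue_on {0..<1}. angular_coeff f (int i - int n) r * of_real (r ^ (n + i + 1))) = 0"
      by (rule integral_eq_zero_AE)
    then show ?thesis by (simp add: c)
  qed
  \<comment> \<open>For n + M < 0 the truncation by \<open>nat\<close> leaves the index 0, whose
    coefficient is 0 by \<open>c0\<close>; then \<open>t\<close> is the zero polynomial.\<close>
  define t where "t = (\<Sum>i\<le>nat (int n + M). monom ((of_nat i + 1) * c i) i)"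
  have coeff: "coeff t i = (of_nat i + 1) * c i" for i
    using c0[of i] by (auto simp: t_def coeff_sum)
  have nz: "of_nat j + 1 \<noteq> (0 :: complex)" for j by (rule of_nat_add_1_neq_0)
  have "toeplitz f (poly (monom 1 n)) = (\<lambda>z. if z \<in> ball 0 1 then poly t z else 0)"
    unfolding toeplitz_poly_iff[OF f] L2_inner_restrict_poly coeff
    using nz by (intro conjI restrict_poly_in_bergman_space allI) (simp add: poly_monom c_def)
  then show ?thesis
  proof (intro exI[of _ t] conjI allI impI)
    show "coeff t i = 2 * (of_nat i + 1) *
        (LINT r|lebesgue_on {0..<1}. angular_coeff f (int i - int n) r * of_real (r ^ (n + i + 1)))" for i
      unfolding coeff c by (simp only: mult.assoc mult.left_commute)
    show "coeff t i = 0" if "int i > int n + M" for i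
      using c0[OF that] by (simp only: coeff mult_zero_right)
  qed
qed

theorem finite_dimensional_toeplitz:
  fixes M :: int and N :: nat
  assumes f: "f \<in> L2_disk"
    and M: "\<And>m::int. m > M \<Longrightarrow> AE r in lebesgue_on {0..<1}. angular_coeff f m r = 0"
    and N: "\<And>k::nat. k \<ge> N \<Longrightarrow> (LINT r|lebesgue_on {0..<1}. angular_coeff f M r * of_real (r ^ k)) \<noteq> 0"
    and g: "g \<in> L2_disk"
    and rank: "finite_rank_on_polys (toeplitz g \<circ> toeplitz f)"
  shows "finite_rank_on_polys (toeplitz g)"
proof -
  obtain B where B: "finite B" and "(toeplitz g \<circ> toeplitz f) ` range poly \<subseteq> cfun.span B"
    using rank unfolding finite_rank_on_polys_def finite_dimensional_def by blast
  then have B2: "toeplitz g (toeplitz f (poly p)) \<in> cfun.span B" for p by auto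
  \<comment> \<open>For k at least \<open>d\<close>, the exponent n = k - M is nonnegative, so z^n
    exists, and n + k + 1 is at least \<open>N\<close>, so the integral in the top coefficient is
    nonzero. The degrees below \<open>d\<close> are covered by the extra vectors in
    \<open>B'\<close>.\<close>
  define d where "d = nat \<bar>M\<bar> + N"
  define B' where "B' = B \<union> (\<lambda>i. toeplitz g (poly (monom 1 i))) ` {..<d}"
  have BB': "cfun.span B \<subseteq> cfun.span B'" by (rule cfun.span_mono) (simp add: B'_def)
  have lin: "toeplitz g (poly q) \<in> cfun.span B'"
    if "toeplitz g (poly (q - Polynomial.smult c t)) \<in> cfun.span B'" "toeplitz g (poly t) \<in> cfun.span B'" for q t c
    using cfun.span_add[OF that(1) cfun.span_scale[OF that(2), of c]]
    by (simp flip: toeplitz_poly_smult[OF g] toeplitz_poly_add[OF g])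
  \<comment> \<open>Induction on a strict bound for the degree: for each k there is some
    \<open>t\<close> of degree exactly k whose image lies in the span, and by \<open>lin\<close> a
    multiple of it may be subtracted to cancel the top coefficient.\<close>
  have "toeplitz g (poly q) \<in> cfun.span B'" if "\<And>i. i \<ge> k \<Longrightarrow> coeff q i = 0" for k q
    using that
  proof (induction k arbitrary: q)
    case 0
    then have "q = 0" by (simp add: poly_eq_iff)
    then show ?case by (simp only: toeplitz_poly_0[OF g] cfun.span_zero)
  next
    case (Suc k)
    obtain t where t: "toeplitz g (poly t) \<in> cfun.span B'" "coeff t k \<noteq> 0" "\<And>i. i > k \<Longrightarrow> coeff t i = 0"
    proof (cases "k < d")
      case True
      then have "toeplitz g (poly (monom 1 k)) \<in> cfun.span B'"
        by (intro cfun.span_base) (auto simp: B'_def)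
      then show thesis by (intro that[of "monom 1 k"]) auto
    next
      case False
      define n where "n = nat (int k - M)"
      have n: "int n = int k - M" and nk: "n + k + 1 \<ge> N"
        using False by (auto simp: n_def d_def)
      obtain t where t: "toeplitz f (poly (monom 1 n)) = (\<lambda>z. if z \<in> ball 0 1 then poly t z else 0)"
        "\<And>i. coeff t i = 2 * (of_nat i + 1) *
          (LINT r|lebesgue_on {0..<1}. angular_coeff f (int i - int n) r * of_real (r ^ (n + i + 1)))"
        "\<And>i. int i > int n + M \<Longrightarrow> coeff t i = 0"
        using toeplitz_monom[where M = M and n = n, OF f M] by blast
      have "toeplitz g (poly t) = toeplitz g (toeplitz f (poly (monom 1 n)))"
        by (rule toeplitz_cong_disk[OF g, symmetric]) (simp add: t(1))
      then have "toeplitz g (poly t) \<in> cfun.span B'" using B2 BB' by auto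
      moreover have "coeff t k \<noteq> 0"
      proof -
        have "of_nat k + 1 \<noteq> (0 :: complex)" by (rule of_nat_add_1_neq_0)
        moreover have "int k - int n = M" using n by simp
        ultimately show ?thesis using N[OF nk] unfolding t(2)[of k] mult_eq_0_iff by simp
      qed
      moreover have "coeff t i = 0" if "i > k" for i using that by (intro t(3)) (simp add: n)
      ultimately show thesis by (rule that)
    qed
    have "coeff (q - Polynomial.smult (coeff q k / coeff t k) t) i = 0" if "i \<ge> k" for i
      using that t Suc.prems[of i] by (cases "i = k") auto
    from lin[OF Suc.IH[OF this] t(1)] show ?case .
  qed
  from this[of "Suc (degree q)" q for q] have "toeplitz g (poly q) \<in> cfun.span B'" for q
    by (simp add: coeff_eq_0)
  then show ?thesis
    using B by (auto simp: finite_rank_on_polys_def finite_dimensional_def B'_def intro!: exI[of _ B'])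
qed

text \<open>\<open>cfun.dependent\<close> is about sets, whereas a relation within an indexed family
  is wanted; a repeated member supplies the relation with coefficients 1 and -1.\<close>

lemma span_finite_dependent:
  assumes B: "finite B" "card B < N" and x: "\<And>i. i < N \<Longrightarrow> x i \<in> cfun.span B"
  obtains c where "\<exists>i<N. c i \<noteq> 0" "\<And>z. (\<Sum>i<N. c i * x i z) = 0"
proof (cases "inj_on x {..<N}")
  case True
  have "cfun.dependent (x ` {..<N})"
  proof (rule ccontr)
    assume "\<not> cfun.dependent (x ` {..<N})"
    then have "card (x ` {..<N}) \<le> card B"
      using cfun.independent_span_bound[OF B(1)] x by blast
    then show False using B(2) True by (simp add: card_image)
  qed
  then obtain u where u: "\<exists>v\<in>x ` {..<N}. u v \<noteq> 0" "(\<Sum>v\<in>x ` {..<N}. (\<lambda>z. u v * v z)) = 0"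
    using cfun.dependent_finite[of "x ` {..<N}"] by auto
  have sum_apply: "(\<Sum>i\<in>I. F i) z = (\<Sum>i\<in>I. F i z)" for I :: "nat set" and F :: "nat \<Rightarrow> complex \<Rightarrow> complex" and z
    by (induction I rule: infinite_finite_induct) simp_all
  have "(\<Sum>i<N. (\<lambda>z. u (x i) * x i z)) = 0"
    using u(2) True by (simp add: sum.reindex)
  then have "(\<Sum>i<N. u (x i) * x i z) = 0" for z
    using sum_apply[of "\<lambda>i z. u (x i) * x i z" "{..<N}" z] by simp
  with u(1) show thesis by (intro that[of "\<lambda>i. u (x i)"]) auto
next
  case False
  then obtain i j where ij: "i < N" "j < N" "i \<noteq> j" "x i = x j" by (auto simp: inj_on_def)
  define c :: "nat \<Rightarrow> complex" where "c k = (if k = i then 1 else if k = j then -1 else 0)" for k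
  have "(\<Sum>k<N. c k * x k z) = 0" for z
  proof -
    have "(\<Sum>k<N. c k * x k z) = (\<Sum>k\<in>{i, j}. c k * x k z)"
      using ij by (intro sum.mono_neutral_right) (auto simp: c_def)
    then show ?thesis using ij by (simp add: c_def)
  qed
  moreover have "c i \<noteq> 0" by (simp add: c_def)
  ultimately show thesis using ij by (intro that[of c]) auto
qed

section \<open>Approximation by symmetric functions on the polydisk\<close>

text \<open>The monic polynomial with roots \<open>z\<close> determines the unordered tuple. It is recorded by its values at
  the natural numbers because the function space is known to be Hausdorff only over a countable
  index type.\<close>

definition root_product :: "nat \<Rightarrow> (nat \<Rightarrow> complex) \<Rightarrow> nat \<Rightarrow> complex" where
  "root_product N z = (\<lambda>k. \<Prod>i<N. of_nat k - z i)"

text \<open>The coordinates beyond \<open>N\<close> are fixed to match the extensional functions of the product measure.\<close>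

definition polydisk :: "nat \<Rightarrow> (nat \<Rightarrow> complex) set" where
  "polydisk N = {z. \<forall>i. z i \<in> (if i < N then cball 0 1 else {undefined})}"

text \<open>The linear span of the products whose integrals are known to vanish. Scalars sit in the
  generators and closure under multiplication is derived instead of postulated, so that an induction
  over \<open>sym_alg\<close> asks for nothing beyond linearity.\<close>

inductive sym_alg :: "nat \<Rightarrow> ((nat \<Rightarrow> complex) \<Rightarrow> complex) \<Rightarrow> bool" for N where
  prod: "sym_alg N (\<lambda>z. c * (\<Prod>i<N. poly s (z i) * cnj (poly t (z i))))"
| add: "sym_alg N \<Phi> \<Longrightarrow> sym_alg N \<Psi> \<Longrightarrow> sym_alg N (\<lambda>z. \<Phi> z + \<Psi> z)"

lemma sym_alg_mult:
  assumes "sym_alg N \<Phi>" "sym_alg N \<Psi>"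
  shows "sym_alg N (\<lambda>z. \<Phi> z * \<Psi> z)"
  using assms(1)
proof induction
  case (prod c s t)
  from assms(2) show ?case
  proof induction
    case (prod c' s' t')
    have "(\<lambda>z. (c * (\<Prod>i<N. poly s (z i) * cnj (poly t (z i)))) * (c' * (\<Prod>i<N. poly s' (z i) * cnj (poly t' (z i))))) =
        (\<lambda>z. (c * c') * (\<Prod>i<N. poly (s * s') (z i) * cnj (poly (t * t') (z i))))"
      by (simp add: prod.distrib mult_ac)
    then show ?case by (simp only: sym_alg.prod)
  next
    case (add \<Phi> \<Psi>)
    then show ?case by (simp only: distrib_left sym_alg.add)
  qed
next
  case (add \<Phi> \<Psi>)
  then show ?case by (simp only: distrib_right sym_alg.add)
qed

lemma sym_alg_const: "sym_alg N (\<lambda>_. c)"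
  using sym_alg.prod[of N c 1 1] by simp

lemma sym_alg_root_product: "sym_alg N (\<lambda>z. root_product N z w)"
  using sym_alg.prod[of N 1 "[:of_nat w, -1:]" 1] by (simp add: root_product_def)

lemma sym_alg_cnj_root_product: "sym_alg N (\<lambda>z. cnj (root_product N z w))"
  using sym_alg.prod[of N 1 1 "[:of_nat w, -1:]"] by (simp add: root_product_def)

text \<open>Exchanging the roles of s and t conjugates a generator, so the algebra contains real and
  imaginary parts. They provide the real-valued separating functions for the Stone-Weierstrass
  theorem.\<close>

lemma sym_alg_Re_root_product: "sym_alg N (\<lambda>z. of_real (Re (root_product N z w)))"
proof -
  have "(\<lambda>z. complex_of_real (Re (root_product N z w))) =
      (\<lambda>z. (1 / 2) * (root_product N z w + cnj (root_product N z w)))"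
    by (auto simp: complex_eq_iff)
  then show ?thesis
    by (simp only: sym_alg_mult sym_alg_const sym_alg.add sym_alg_root_product sym_alg_cnj_root_product)
qed

lemma sym_alg_Im_root_product: "sym_alg N (\<lambda>z. of_real (Im (root_product N z w)))"
proof -
  have "(\<lambda>z. complex_of_real (Im (root_product N z w))) =
      (\<lambda>z. (- \<i> / 2) * (root_product N z w + (- 1) * cnj (root_product N z w)))"
    by (auto simp: complex_eq_iff)
  then show ?thesis
    by (simp only: sym_alg_mult sym_alg_const sym_alg.add sym_alg_root_product sym_alg_cnj_root_product)
qed

text \<open>Tychonoff's theorem: every coordinate ranges over a closed disk or a singleton.\<close>

lemma compact_polydisk: "compact (polydisk N)"
proof -
  have "compactin (product_topology (\<lambda>_. euclidean) UNIV) (PiE UNIV (\<lambda>i. if i < N then cball (0 :: complex) 1 else {undefined}))"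
    by (subst compactin_PiE) auto
  moreover have "PiE UNIV (\<lambda>i. if i < N then cball (0 :: complex) 1 else {undefined}) = polydisk N"
    by (auto simp: polydisk_def PiE_def Pi_def)
  ultimately show ?thesis
    by (simp add: euclidean_product_topology)
qed

lemma continuous_on_root_product: "continuous_on S (root_product N)"
  unfolding root_product_def
  by (intro continuous_on_coordinatewise_then_product continuous_on_prod continuous_on_diff continuous_on_const
      continuous_on_subset[OF continuous_on_product_coordinates]) auto

text \<open>Two polynomials that agree at all natural numbers are equal and have the same multiset
  of roots, and the product of the values of \<open>h\<close> depends on that multiset only.\<close>

lemma root_product_eq_imp_prod_eq:
  fixes h :: "complex \<Rightarrow> complex"
  assumes "root_product N z = root_product N z'"
  shows "(\<Prod>i<N. h (z i)) = (\<Prod>i<N. h (z' i))"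
proof -
  have poly_eq: "poly (\<Prod>i<N. [:- y i, 1:]) (of_nat k) = root_product N y k" for y k
    by (simp add: root_product_def poly_prod)
  have "(\<Prod>i<N. [:- z i, 1:]) = (\<Prod>i<N. [:- z' i, 1:])"
  proof (rule ccontr)
    let ?d = "(\<Prod>i<N. [:- z i, 1:]) - (\<Prod>i<N. [:- z' i, 1:])"
    assume "(\<Prod>i<N. [:- z i, 1:]) \<noteq> (\<Prod>i<N. [:- z' i, 1:])"
    then have "finite {w. poly ?d w = 0}" by (intro poly_roots_finite) simp
    moreover have "range of_nat \<subseteq> {w. poly ?d w = 0}"
      using assms by (auto simp: poly_eq)
    ultimately have "finite (range (of_nat :: nat \<Rightarrow> complex))"
      by (rule finite_subset[rotated])
    then have "finite (UNIV :: nat set)"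
      by (rule finite_imageD) (simp add: inj_on_def)
    then show False by simp
  qed
  moreover have "proots (\<Prod>i<N. [:- y i, 1:]) = image_mset y (mset_set {..<N})" for y :: "nat \<Rightarrow> complex"
  proof (induction N)
    case (Suc N)
    have "(\<Prod>i<N. [:- y i, 1:]) \<noteq> 0" by simp
    then have "proots ((\<Prod>i<N. [:- y i, 1:]) * [:- y N, 1:]) = proots (\<Prod>i<N. [:- y i, 1:]) + proots [:- y N, 1:]"
      by (intro proots_mult) simp_all
    then show ?case
      by (simp only: prod.lessThan_Suc Suc.IH) (simp add: lessThan_Suc)
  qed simp
  ultimately have "image_mset z (mset_set {..<N}) = image_mset z' (mset_set {..<N})"
    by metis
  then have "prod_mset (image_mset h (image_mset z (mset_set {..<N}))) = prod_mset (image_mset h (image_mset z' (mset_set {..<N})))"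
    by simp
  then show ?thesis by (simp add: image_mset.compositionality o_def prod_unfold_prod_mset)
qed

text \<open>A continuous map from a compact space to a Hausdorff space is a quotient map onto its
  image: the preimage of a closed set under \<open>f\<close> is the image of a compact set, hence
  closed.\<close>

lemma factor_through_root_product:
  fixes \<Phi> :: "(nat \<Rightarrow> complex) \<Rightarrow> 'b::t2_space"
  assumes cont: "continuous_on (polydisk N) \<Phi>"
    and eq: "\<And>z z'. z \<in> polydisk N \<Longrightarrow> z' \<in> polydisk N \<Longrightarrow> root_product N z = root_product N z' \<Longrightarrow> \<Phi> z = \<Phi> z'"
  obtains f where "continuous_on (root_product N ` polydisk N) f" "\<And>z. z \<in> polydisk N \<Longrightarrow> f (root_product N z) = \<Phi> z"
proof -
  define f where "f x = \<Phi> (SOME z. z \<in> polydisk N \<and> root_product N z = x)" for x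
  have f: "f (root_product N z) = \<Phi> z" if "z \<in> polydisk N" for z
  proof -
    have "(SOME y. y \<in> polydisk N \<and> root_product N y = root_product N z) \<in> polydisk N \<and>
        root_product N (SOME y. y \<in> polydisk N \<and> root_product N y = root_product N z) = root_product N z"
      by (rule someI[of _ z]) (use that in simp)
    then show ?thesis unfolding f_def using eq that by blast
  qed
  have "continuous_on (root_product N ` polydisk N) f"
    unfolding continuous_on_closed_invariant
  proof (intro allI impI)
    fix C :: "'b set" assume "closed C"
    then have "closedin (top_of_set (polydisk N)) (polydisk N \<inter> \<Phi> -` C)"
      using cont continuous_closedin_preimage by blast
    then have "compact (polydisk N \<inter> \<Phi> -` C)"
      using compact_polydisk closedin_compact by blast
    then have "compact (root_product N ` (polydisk N \<inter> \<Phi> -` C))"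
      by (intro compact_continuous_image continuous_on_root_product)
    then have "closed (root_product N ` (polydisk N \<inter> \<Phi> -` C))" by (rule compact_imp_closed)
    moreover have "root_product N ` (polydisk N \<inter> \<Phi> -` C) \<inter> root_product N ` polydisk N = f -` C \<inter> root_product N ` polydisk N"
      using f by (auto simp: image_iff)
    ultimately show "\<exists>A. closed A \<and> A \<inter> root_product N ` polydisk N = f -` C \<inter> root_product N ` polydisk N"
      by blast
  qed
  with f show thesis by (rule that[rotated])
qed

text \<open>Stone-Weierstrass is applied on the image \<open>X\<close> of the polydisk, a model of
  its quotient by permutations, because symmetric functions cannot separate points of the polydisk
  itself. On \<open>X\<close> the coordinates separate points.\<close>

lemma sym_alg_dense_real:
  fixes \<Phi> :: "(nat \<Rightarrow> complex) \<Rightarrow> real"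
  assumes cont: "continuous_on (polydisk N) \<Phi>"
    and eq: "\<And>z z'. z \<in> polydisk N \<Longrightarrow> z' \<in> polydisk N \<Longrightarrow> root_product N z = root_product N z' \<Longrightarrow> \<Phi> z = \<Phi> z'"
    and e: "e > 0"
  shows "\<exists>\<Psi>. sym_alg N \<Psi> \<and> (\<forall>z\<in>polydisk N. cmod (of_real (\<Phi> z) - \<Psi> z) < e)"
proof -
  define X where "X = root_product N ` polydisk N"
  define R where "R = {F. continuous_on X F \<and> (\<exists>\<Psi>. sym_alg N \<Psi> \<and> (\<forall>z\<in>polydisk N. of_real (F (root_product N z)) = \<Psi> z))}"
  interpret function_ring_on R X
  proof
    show "compact X"
      unfolding X_def by (intro compact_continuous_image continuous_on_root_product compact_polydisk)
    show "continuous_on X F" if "F \<in> R" for F using that by (simp add: R_def)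
    show "(\<lambda>x. F x + G x) \<in> R" if "F \<in> R" "G \<in> R" for F G
      using that unfolding R_def by (auto intro!: continuous_on_add) (metis sym_alg.add)
    show "(\<lambda>x. F x * G x) \<in> R" if "F \<in> R" "G \<in> R" for F G
      using that unfolding R_def by (auto intro!: continuous_on_mult) (metis sym_alg_mult)
    show "(\<lambda>_. c) \<in> R" for c
      unfolding R_def by (auto intro!: exI[of _ "\<lambda>_. complex_of_real c"] sym_alg_const)
    show "\<exists>F\<in>R. F x \<noteq> F y" if "x \<in> X" "y \<in> X" "x \<noteq> y" for x y
    proof -
      obtain w where w: "x w \<noteq> y w" using \<open>x \<noteq> y\<close> by auto
      have cont_w: "continuous_on X (\<lambda>x. x w)"
        by (rule continuous_on_subset[OF continuous_on_product_coordinates]) simp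
      have "(\<lambda>x. Re (x w)) \<in> R"
        unfolding R_def using continuous_on_Re[OF cont_w] sym_alg_Re_root_product[of N w] by blast
      moreover have "(\<lambda>x. Im (x w)) \<in> R"
        unfolding R_def using continuous_on_Im[OF cont_w] sym_alg_Im_root_product[of N w] by blast
      ultimately show ?thesis using w by (metis complex_eqI)
    qed
  qed
  obtain f where f: "continuous_on X f" "\<And>z. z \<in> polydisk N \<Longrightarrow> f (root_product N z) = \<Phi> z"
    using factor_through_root_product[OF cont eq] unfolding X_def by metis
  obtain F where F: "F \<in> R" "\<And>x. x \<in> X \<Longrightarrow> \<bar>f x - F x\<bar> < e"
    using Stone_Weierstrass_basic[OF f(1) e] by blast
  then obtain \<Psi> where \<Psi>: "sym_alg N \<Psi>" "\<And>z. z \<in> polydisk N \<Longrightarrow> of_real (F (root_product N z)) = \<Psi> z"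
    unfolding R_def by blast
  have "cmod (of_real (\<Phi> z) - \<Psi> z) < e" if z: "z \<in> polydisk N" for z
  proof -
    have "cmod (of_real (\<Phi> z) - \<Psi> z) = cmod (of_real (f (root_product N z) - F (root_product N z)))"
      using f(2)[OF z] \<Psi>(2)[OF z] by simp
    also have "\<dots> < e" using F(2)[of "root_product N z"] z unfolding norm_of_real by (simp add: X_def)
    finally show ?thesis .
  qed
  with \<Psi>(1) show ?thesis by blast
qed

text \<open>Real and imaginary part of the symmetric product are approximated separately, each
  within e / 2, by the real form of Stone-Weierstrass.\<close>

lemma sym_alg_dense_prod:
  fixes h :: "complex \<Rightarrow> complex"
  assumes h: "continuous_on (cball 0 1) h" and e: "e > 0"
  shows "\<exists>\<Psi>. sym_alg N \<Psi> \<and> (\<forall>z\<in>polydisk N. cmod ((\<Prod>i<N. h (z i)) - \<Psi> z) < e)"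
proof -
  define \<Phi> where "\<Phi> z = (\<Prod>i<N. h (z i))" for z
  have cont: "continuous_on (polydisk N) \<Phi>"
    unfolding \<Phi>_def
  proof (intro continuous_on_prod)
    fix i assume "i \<in> {..<N}"
    then have "z i \<in> cball 0 1" if "z \<in> polydisk N" for z
      using that unfolding polydisk_def by (metis (mono_tags, lifting) mem_Collect_eq lessThan_iff)
    then have "(\<lambda>z. z i) ` polydisk N \<subseteq> cball 0 1" by blast
    then show "continuous_on (polydisk N) (\<lambda>z. h (z i))"
      by (intro continuous_on_compose2[OF h] continuous_on_subset[OF continuous_on_product_coordinates]) auto
  qed
  have eq: "\<Phi> z = \<Phi> z'" if "root_product N z = root_product N z'" for z z'
    unfolding \<Phi>_def by (rule root_product_eq_imp_prod_eq[OF that])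
  obtain A where A: "sym_alg N A" "\<And>z. z \<in> polydisk N \<Longrightarrow> cmod (of_real (Re (\<Phi> z)) - A z) < e / 2"
  proof -
    have "\<exists>\<Psi>. sym_alg N \<Psi> \<and> (\<forall>z\<in>polydisk N. cmod (of_real (Re (\<Phi> z)) - \<Psi> z) < e / 2)"
    proof (rule sym_alg_dense_real[OF continuous_on_Re[OF cont]])
      show "Re (\<Phi> z) = Re (\<Phi> z')" if "root_product N z = root_product N z'" for z z'
        using eq[OF that] by simp
    qed (use e in simp)
    then show thesis using that by blast
  qed
  obtain B where B: "sym_alg N B" "\<And>z. z \<in> polydisk N \<Longrightarrow> cmod (of_real (Im (\<Phi> z)) - B z) < e / 2"
  proof -
    have "\<exists>\<Psi>. sym_alg N \<Psi> \<and> (\<forall>z\<in>polydisk N. cmod (of_real (Im (\<Phi> z)) - \<Psi> z) < e / 2)"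
    proof (rule sym_alg_dense_real[OF continuous_on_Im[OF cont]])
      show "Im (\<Phi> z) = Im (\<Phi> z')" if "root_product N z = root_product N z'" for z z'
        using eq[OF that] by simp
    qed (use e in simp)
    then show thesis using that by blast
  qed
  have "cmod (\<Phi> z - (A z + \<i> * B z)) < e" if z: "z \<in> polydisk N" for z
  proof -
    have "\<Phi> z - (A z + \<i> * B z) = (of_real (Re (\<Phi> z)) - A z) + \<i> * (of_real (Im (\<Phi> z)) - B z)"
      by (subst complex_eq[of "\<Phi> z"]) (simp add: algebra_simps)
    also have "cmod \<dots> \<le> cmod (of_real (Re (\<Phi> z)) - A z) + cmod (of_real (Im (\<Phi> z)) - B z)"
      by (rule norm_triangle_le) (simp add: norm_mult)
    finally show ?thesis using A(2)[OF z] B(2)[OF z] by simp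
  qed
  moreover have "sym_alg N (\<lambda>z. A z + \<i> * B z)"
    by (intro sym_alg.add A(1) sym_alg_mult[OF sym_alg_const B(1)])
  ultimately show ?thesis unfolding \<Phi>_def by blast
qed

section \<open>Toeplitz operators of finite rank\<close>

lemma det_leibniz:
  "Determinant.det (mat N N (\<lambda>(i, j). m i j)) = (\<Sum>p | p permutes {..<N}. signof p * (\<Prod>i<N. m i (p i)))"
proof -
  have "Determinant.det (mat N N (\<lambda>(i, j). m i j)) =
      (\<Sum>p | p permutes {0..<N}. signof p * (\<Prod>i = 0..<N. mat N N (\<lambda>(i, j). m i j) $$ (i, p i)))"
    by (rule det_def') simp
  also have "\<dots> = (\<Sum>p | p permutes {..<N}. signof p * (\<Prod>i<N. m i (p i)))"
    unfolding atLeast0LessThan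
    by (intro sum.cong refl arg_cong2[of _ _ _ _ times] prod.cong)
       (auto simp: permutes_in_image[of _ "{..<N}", simplified])
  finally show ?thesis .
qed

lemma det_leibniz_permute_rows:
  assumes "p permutes {..<N}"
  shows "(\<Sum>q | q permutes {..<N}. signof q * (\<Prod>i<N. m (p i) (q i))) =
    signof p * Determinant.det (mat N N (\<lambda>(i, j). m i j))"
proof -
  have p: "p i < N" if "i < N" for i
    using permutes_in_image[OF assms, of i] that by simp
  have "(\<Sum>q | q permutes {..<N}. signof q * (\<Prod>i<N. m (p i) (q i))) =
      Determinant.det (mat N N (\<lambda>(i, j). m (p i) j))"
    by (rule det_leibniz[symmetric])
  also have "mat N N (\<lambda>(i, j). m (p i) j) = mat N N (\<lambda>(i, j). mat N N (\<lambda>(i, j). m i j) $$ (p i, j))"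
    using p by (intro eq_matI) auto
  also have "Determinant.det \<dots> = signof p * Determinant.det (mat N N (\<lambda>(i, j). m i j))"
    using assms by (intro det_permute_rows) (auto simp: atLeast0LessThan)
  finally show ?thesis .
qed

lemma det_eq_0_iff_kernel:
  fixes m :: "nat \<Rightarrow> nat \<Rightarrow> 'a::field"
  shows "Determinant.det (mat N N (\<lambda>(i, j). m i j)) = 0 \<longleftrightarrow>
    (\<exists>v. (\<exists>i<N. v i \<noteq> 0) \<and> (\<forall>i<N. (\<Sum>j<N. m i j * v j) = 0))"
proof -
  let ?A = "mat N N (\<lambda>(i, j). m i j)"
  have mult: "?A *\<^sub>v v = 0\<^sub>v N \<longleftrightarrow> (\<forall>i<N. (\<Sum>j<N. m i j * vec_index v j) = 0)" if "v \<in> carrier_vec N" for v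
    using that by (auto simp: vec_eq_iff scalar_prod_def atLeast0LessThan intro!: eq_vecI)
  have nz: "v \<noteq> 0\<^sub>v N \<longleftrightarrow> (\<exists>i<N. vec_index v i \<noteq> 0)" if "v \<in> carrier_vec N" for v :: "'a Matrix.vec"
    using that by (auto intro!: eq_vecI)
  have "Determinant.det ?A = 0 \<longleftrightarrow> (\<exists>v. v \<in> carrier_vec N \<and> v \<noteq> 0\<^sub>v N \<and> ?A *\<^sub>v v = 0\<^sub>v N)"
    by (rule det_0_iff_vec_prod_zero_field) simp
  also have "\<dots> \<longleftrightarrow> (\<exists>v. (\<exists>i<N. v i \<noteq> 0) \<and> (\<forall>i<N. (\<Sum>j<N. m i j * v j) = 0))"
  proof
    assume "\<exists>v. v \<in> carrier_vec N \<and> v \<noteq> 0\<^sub>v N \<and> ?A *\<^sub>v v = 0\<^sub>v N"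
    then show "\<exists>v. (\<exists>i<N. v i \<noteq> 0) \<and> (\<forall>i<N. (\<Sum>j<N. m i j * v j) = 0)"
      using mult nz by blast
  next
    assume "\<exists>v. (\<exists>i<N. v i \<noteq> 0) \<and> (\<forall>i<N. (\<Sum>j<N. m i j * v j) = 0)"
    then obtain v where v: "\<exists>i<N. v i \<noteq> 0" "\<forall>i<N. (\<Sum>j<N. m i j * v j) = 0" by blast
    have c: "Matrix.vec N v \<in> carrier_vec N" by simp
    show "\<exists>v. v \<in> carrier_vec N \<and> v \<noteq> 0\<^sub>v N \<and> ?A *\<^sub>v v = 0\<^sub>v N"
      using v by (intro exI[of _ "Matrix.vec N v"] conjI c) (simp_all only: mult[OF c] nz[OF c], auto)
  qed
  finally show ?thesis .
qed

text \<open>A linear relation among the rows is a kernel vector of the transpose.\<close>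

lemma det_eq_0_left_kernel:
  fixes m :: "nat \<Rightarrow> nat \<Rightarrow> 'a::field"
  assumes "\<exists>i<N. v i \<noteq> 0" "\<And>j. j < N \<Longrightarrow> (\<Sum>i<N. v i * m i j) = 0"
  shows "Determinant.det (mat N N (\<lambda>(i, j). m i j)) = 0"
proof -
  have "Determinant.det (mat N N (\<lambda>(i, j). m j i)) = 0"
    unfolding det_eq_0_iff_kernel using assms by (auto simp: mult.commute intro!: exI[of _ v])
  moreover have "mat N N (\<lambda>(i, j). m j i) = transpose_mat (mat N N (\<lambda>(i, j). m i j))"
    by (intro eq_matI) auto
  ultimately show ?thesis
    by (simp add: Determinant.det_transpose[of _ N])
qed

text \<open>The determinant of the matrix with entries a_j(x_i), in Leibniz's expansion. For the
  powers a_j(z) = z^j it is the Vandermonde determinant.\<close>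

definition alternant :: "nat \<Rightarrow> (nat \<Rightarrow> 'a \<Rightarrow> complex) \<Rightarrow> (nat \<Rightarrow> 'a) \<Rightarrow> complex" where
  "alternant N a x = (\<Sum>p | p permutes {..<N}. signof p * (\<Prod>i<N. a (p i) (x i)))"

text \<open>Both alternants are expanded and each term is integrated, by Fubini, to a product of
  single integrals. For fixed p the sum over q is the determinant with rows permuted by p; its sign
  cancels the sign of p, and the N! choices of p contribute equally.\<close>

lemma andreief:
  fixes a b :: "nat \<Rightarrow> 'a \<Rightarrow> complex"
  assumes M: "sigma_finite_measure M"
    and int: "\<And>i j. i < N \<Longrightarrow> j < N \<Longrightarrow> integrable M (\<lambda>x. a i x * b j x * w x)"
  shows "integrable (Pi\<^sub>M {..<N} (\<lambda>_. M)) (\<lambda>x. alternant N a x * alternant N b x * (\<Prod>i<N. w (x i)))"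
    and "(LINT x|Pi\<^sub>M {..<N} (\<lambda>_. M). alternant N a x * alternant N b x * (\<Prod>i<N. w (x i))) =
      fact N * Determinant.det (mat N N (\<lambda>(i, j). LINT x|M. a i x * b j x * w x))"
proof -
  interpret product_sigma_finite "\<lambda>_ :: nat. M" using M by (simp add: product_sigma_finite_def)
  let ?P = "{p. p permutes {..<N}}"
  have less: "p i < N" if "p \<in> ?P" "i < N" for p i
    using permutes_in_image[of p "{..<N}" i] that by simp
  let ?f = "\<lambda>p q i x. a (p i) x * b (q i) x * w x"
  have int': "integrable M (?f p q i)" if "p \<in> ?P" "q \<in> ?P" "i \<in> {..<N}" for p q i
    using int[OF less[OF that(1), of i] less[OF that(2), of i]] that(3) by simp
  have expand: "alternant N a x * alternant N b x * (\<Prod>i<N. w (x i)) =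
      (\<Sum>p\<in>?P. \<Sum>q\<in>?P. (signof p * signof q) * (\<Prod>i<N. ?f p q i (x i)))" for x
  proof -
    have "alternant N a x * alternant N b x =
        (\<Sum>p\<in>?P. \<Sum>q\<in>?P. (signof p * (\<Prod>i<N. a (p i) (x i))) * (signof q * (\<Prod>i<N. b (q i) (x i))))"
      unfolding alternant_def by (rule sum_product)
    then show ?thesis
      by (simp only: sum_distrib_right, intro sum.cong refl) (simp add: prod.distrib mult_ac)
  qed
  have prod_int: "integrable (Pi\<^sub>M {..<N} (\<lambda>_. M)) (\<lambda>x. \<Prod>i<N. ?f p q i (x i))"
    if "p \<in> ?P" "q \<in> ?P" for p q
    by (rule product_integrable_prod) (use int'[OF that] in auto)
  show "integrable (Pi\<^sub>M {..<N} (\<lambda>_. M)) (\<lambda>x. alternant N a x * alternant N b x * (\<Prod>i<N. w (x i)))"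
    unfolding expand by (intro Bochner_Integration.integrable_sum integrable_mult_right prod_int)
  have "(LINT x|Pi\<^sub>M {..<N} (\<lambda>_. M). alternant N a x * alternant N b x * (\<Prod>i<N. w (x i))) =
      (\<Sum>p\<in>?P. \<Sum>q\<in>?P. LINT x|Pi\<^sub>M {..<N} (\<lambda>_. M). (signof p * signof q) * (\<Prod>i<N. ?f p q i (x i)))"
    unfolding expand
    by (subst Bochner_Integration.integral_sum, intro Bochner_Integration.integrable_sum integrable_mult_right prod_int,
        assumption+, intro sum.cong refl Bochner_Integration.integral_sum integrable_mult_right prod_int)
  also have "\<dots> = (\<Sum>p\<in>?P. \<Sum>q\<in>?P. (signof p * signof q) * (\<Prod>i<N. LINT x|M. a (p i) x * b (q i) x * w x))"
  proof (intro sum.cong refl)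
    fix p q assume pq: "p \<in> ?P" "q \<in> ?P"
    have "(LINT x|Pi\<^sub>M {..<N} (\<lambda>_. M). (\<Prod>i<N. ?f p q i (x i))) = (\<Prod>i<N. LINT x|M. ?f p q i x)"
      by (rule product_integral_prod) (use int'[OF pq] in auto)
    then show "(LINT x|Pi\<^sub>M {..<N} (\<lambda>_. M). (signof p * signof q) * (\<Prod>i<N. ?f p q i (x i))) =
       (signof p * signof q) * (\<Prod>i<N. LINT x|M. a (p i) x * b (q i) x * w x)"
      by (simp only: integral_mult_right_zero)
  qed
  also have "\<dots> = (\<Sum>p\<in>?P. signof p * (\<Sum>q\<in>?P. signof q * (\<Prod>i<N. LINT x|M. a (p i) x * b (q i) x * w x)))"
    by (simp only: sum_distrib_left mult.assoc)
  also have "\<dots> = (\<Sum>p\<in>?P. signof p * (signof p * Determinant.det (mat N N (\<lambda>(i, j). LINT x|M. a i x * b j x * w x))))"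
    by (intro sum.cong refl arg_cong2[of _ _ _ _ times] det_leibniz_permute_rows) simp
  also have "\<dots> = (\<Sum>p\<in>?P. Determinant.det (mat N N (\<lambda>(i, j). LINT x|M. a i x * b j x * w x)))"
    by (intro sum.cong refl) (simp add: sign_def)
  also have "\<dots> = fact N * Determinant.det (mat N N (\<lambda>(i, j). LINT x|M. a i x * b j x * w x))"
    by (simp add: card_permutations)
  finally show "(LINT x|Pi\<^sub>M {..<N} (\<lambda>_. M). alternant N a x * alternant N b x * (\<Prod>i<N. w (x i))) =
      fact N * Determinant.det (mat N N (\<lambda>(i, j). LINT x|M. a i x * b j x * w x))" .
qed

section \<open>From finite rank to a vanishing symbol\<close>

text \<open>One more function than there are vectors in \<open>B\<close> forces a relation among the
  images of s z^i. The corresponding polynomial \<open>P\<close> makes g P orthogonal to all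
  polynomials, and testing against t z^j yields a relation among the rows. The size of the matrix
  depends on \<open>B\<close> alone, not on s or t.\<close>

lemma finite_rank_imp_det_eq_0:
  assumes g: "g \<in> L2_disk" and rank: "finite_rank_on_polys (toeplitz g)"
  shows "\<exists>N. \<forall>s t. Determinant.det (mat N N (\<lambda>(i, j).
    LINT z|disk_measure. z ^ i * cnj (z ^ j) * (poly s z * cnj (poly t z) * g z))) = 0"
proof -
  obtain B where B: "finite B" and "toeplitz g ` range poly \<subseteq> cfun.span B"
    using rank unfolding finite_rank_on_polys_def finite_dimensional_def by blast
  then have span: "toeplitz g (poly p) \<in> cfun.span B" for p by auto
  let ?N = "Suc (card B)"
  have "Determinant.det (mat ?N ?N (\<lambda>(i, j).
    LINT z|disk_measure. z ^ i * cnj (z ^ j) * (poly s z * cnj (poly t z) * g z))) = 0" for s t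
  proof -
    obtain c where c: "\<exists>i<?N. c i \<noteq> 0" "\<And>z. (\<Sum>i<?N. c i * toeplitz g (poly (s * monom 1 i)) z) = 0"
      by (rule span_finite_dependent[OF B lessI, of "\<lambda>i. toeplitz g (poly (s * monom 1 i))"]) (auto intro: span)
    define P where "P = (\<Sum>i<?N. Polynomial.smult (c i) (s * monom 1 i))"
    have gL: "(\<lambda>z. g z * poly p z) \<in> L2_disk" for p by (rule L2_disk_poly_mult[OF g])
    have sum: "L2_inner (\<lambda>z. g z * poly P z) v = (\<Sum>i<?N. c i * L2_inner (\<lambda>z. g z * poly (s * monom 1 i) z) v)"
      if "v \<in> L2_disk" for v
    proof -
      have "(\<lambda>z. g z * poly P z) = (\<lambda>z. \<Sum>i<?N. c i * (g z * poly (s * monom 1 i) z))"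
        by (simp only: P_def poly_sum poly_smult sum_distrib_left mult.left_commute)
      then show ?thesis
        using that gL by (simp only: L2_inner_sum_left L2_disk_cmult L2_inner_cmult_left)
    qed
    have P0: "L2_inner (\<lambda>z. g z * poly P z) (\<lambda>z. z ^ k) = 0" for k
    proof -
      have "L2_inner (\<lambda>z. g z * poly P z) (\<lambda>z. z ^ k) =
          (\<Sum>i<?N. c i * L2_inner (toeplitz g (poly (s * monom 1 i))) (\<lambda>z. z ^ k))"
        by (simp only: sum[OF power_in_L2_disk] toeplitz_poly(2)[OF g])
      also have "\<dots> = L2_inner (\<lambda>z. \<Sum>i<?N. c i * toeplitz g (poly (s * monom 1 i)) z) (\<lambda>z. z ^ k)"
        by (simp only: L2_inner_sum_left L2_disk_cmult bergman_spaceD(1)[OF toeplitz_poly(1)[OF g]]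
            power_in_L2_disk L2_inner_cmult_left)
      also have "\<dots> = 0" by (simp only: c(2)) (simp add: L2_inner_def)
      finally show ?thesis .
    qed
    have Pq: "L2_inner (\<lambda>z. g z * poly P z) (poly q) = 0" for q
    proof -
      have "poly q = (\<lambda>z. \<Sum>k\<le>degree q. coeff q k * z ^ k)" by (simp add: poly_altdef fun_eq_iff)
      then have "L2_inner (\<lambda>z. g z * poly P z) (poly q) =
          (\<Sum>k\<le>degree q. L2_inner (\<lambda>z. g z * poly P z) (\<lambda>z. coeff q k * z ^ k))"
        by (simp only: L2_inner_sum_right L2_disk_cmult power_in_L2_disk gL)
      then show ?thesis by (simp add: L2_inner_cmult_right P0)
    qed
    have one: "(\<lambda>_. 1) \<in> L2_disk" using power_in_L2_disk[of 0] by simp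
    have poly_L2: "poly q \<in> L2_disk" for q
      using L2_disk_poly_mult[OF one, of q] by simp
    show ?thesis
    proof (rule det_eq_0_left_kernel[OF c(1)])
      fix j
      have "(LINT z|disk_measure. z ^ i * cnj (z ^ j) * (poly s z * cnj (poly t z) * g z)) =
          L2_inner (\<lambda>z. g z * poly (s * monom 1 i) z) (poly (t * monom 1 j))" for i
        unfolding L2_inner_def by (intro Bochner_Integration.integral_cong refl) (simp add: poly_monom mult_ac)
      then show "(\<Sum>i<?N. c i * (LINT z|disk_measure. z ^ i * cnj (z ^ j) * (poly s z * cnj (poly t z) * g z))) = 0"
        using sum[OF poly_L2, of "t * monom 1 j"] Pq by simp
    qed
  qed
  then show ?thesis by (intro exI[of _ ?N] allI)
qed

lemma integrable_L2_disk:
  assumes "g \<in> L2_disk"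
  shows "integrable disk_measure g"
  using integrable_L2_inner[OF assms power_in_L2_disk[of 0]] by simp

lemma integrable_monomials_weight:
  assumes g: "g \<in> L2_disk" and h: "h \<in> borel_measurable disk_measure" "\<And>z. z \<in> ball 0 1 \<Longrightarrow> cmod (h z) \<le> C"
  shows "integrable disk_measure (\<lambda>z. z ^ i * cnj (z ^ j) * (h z * g z))"
proof (rule Bochner_Integration.integrable_bound)
  show "integrable disk_measure (\<lambda>z. C * cmod (g z))"
    using integrable_L2_disk[OF g] by auto
  have [measurable]: "(\<lambda>z. z ^ i * cnj (z ^ j)) \<in> borel_measurable disk_measure"
    by (intro continuous_on_measurable_disk continuous_intros)
  show "(\<lambda>z. z ^ i * cnj (z ^ j) * (h z * g z)) \<in> borel_measurable disk_measure"
    using h(1) L2_diskD(1)[OF g] by measurable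
  show "AE z in disk_measure. norm (z ^ i * cnj (z ^ j) * (h z * g z)) \<le> norm (C * cmod (g z))"
  proof (rule AE_I2)
    fix z assume "z \<in> space disk_measure"
    then have z: "z \<in> ball 0 1" by simp
    have "norm (z ^ i * cnj (z ^ j) * (h z * g z)) = (cmod z ^ i * cmod z ^ j) * (cmod (h z) * cmod (g z))"
      by (simp add: norm_mult norm_power)
    also have "\<dots> \<le> 1 * (C * cmod (g z))"
      using z by (intro mult_mono mult_le_one power_le_one h(2)) (auto intro: order_trans[OF _ h(2)])
    also have "\<dots> \<le> norm (C * cmod (g z))" by simp
    finally show "norm (z ^ i * cnj (z ^ j) * (h z * g z)) \<le> norm (C * cmod (g z))" .
  qed
qed

text \<open>By Andreief's identity the determinant is, up to N!, the integral of the product of the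
  weights against the fixed function \<open>G\<close>. That integral is linear in the function
  multiplying \<open>G\<close>, so it vanishes on \<open>sym_alg\<close>, and uniform approximation
  extends this to the product of the values of \<open>h\<close>.\<close>

lemma det_weight_eq_0:
  assumes g: "g \<in> L2_disk"
    and zero: "\<And>s t. Determinant.det (mat N N (\<lambda>(i, j).
      LINT z|disk_measure. z ^ i * cnj (z ^ j) * (poly s z * cnj (poly t z) * g z))) = 0"
    and h: "continuous_on (cball 0 1) h"
  shows "Determinant.det (mat N N (\<lambda>(i, j). LINT z|disk_measure. z ^ i * cnj (z ^ j) * (h z * g z))) = 0"
proof -
  let ?PM = "Pi\<^sub>M {..<N} (\<lambda>_. disk_measure)"
  \<comment> \<open>The squared modulus of the Vandermonde determinant times the product of the
    values of \<open>g\<close>: the part of the integrand that does not involve the weight.\<close>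
  define G where "G x = alternant N (\<lambda>i z. z ^ i) x * alternant N (\<lambda>i z. cnj (z ^ i)) x * (\<Prod>i<N. g (x i))" for x
  have sf: "sigma_finite_measure disk_measure" by unfold_locales
  have weight: "integrable ?PM (\<lambda>x. (\<Prod>i<N. k (x i)) * G x)"
    "(LINT x|?PM. (\<Prod>i<N. k (x i)) * G x) =
      fact N * Determinant.det (mat N N (\<lambda>(i, j). LINT z|disk_measure. z ^ i * cnj (z ^ j) * (k z * g z)))"
    if k: "continuous_on (cball 0 1) k" for k
  proof -
    have "compact (k ` cball 0 1)" using k by (intro compact_continuous_image) auto
    then obtain C where C: "\<And>z. z \<in> cball 0 1 \<Longrightarrow> cmod (k z) \<le> C"
      by (meson bounded_iff compact_imp_bounded imageI)
    have "continuous_on (ball 0 1) k" by (rule continuous_on_subset[OF k]) auto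
    then have int: "integrable disk_measure (\<lambda>z. z ^ i * cnj (z ^ j) * (k z * g z))" for i j
      by (intro integrable_monomials_weight[OF g, of _ C] continuous_on_measurable_disk C) auto
    have eq: "(\<lambda>x. (\<Prod>i<N. k (x i)) * G x) = (\<lambda>x. alternant N (\<lambda>i z. z ^ i) x * alternant N (\<lambda>i z. cnj (z ^ i)) x * (\<Prod>i<N. k (x i) * g (x i)))"
      unfolding G_def by (simp add: prod.distrib mult_ac)
    show "integrable ?PM (\<lambda>x. (\<Prod>i<N. k (x i)) * G x)"
      unfolding eq by (rule andreief(1)[OF sf int])
    show "(LINT x|?PM. (\<Prod>i<N. k (x i)) * G x) =
      fact N * Determinant.det (mat N N (\<lambda>(i, j). LINT z|disk_measure. z ^ i * cnj (z ^ j) * (k z * g z)))"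
      unfolding eq by (rule andreief(2)[OF sf int])
  qed
  \<comment> \<open>The constant weight 1. Integrability of \<open>G\<close> turns a uniform error
    on the polydisk into an error of the integral.\<close>
  have G_int: "integrable ?PM G"
    using weight(1)[of "\<lambda>_. 1"] by simp
  have sym: "integrable ?PM (\<lambda>x. \<Psi> x * G x) \<and> (LINT x|?PM. \<Psi> x * G x) = 0" if "sym_alg N \<Psi>" for \<Psi>
    using that
  proof induction
    case (prod c s t)
    have cont: "continuous_on (cball 0 1) (\<lambda>z. poly s z * cnj (poly t z))" by (intro continuous_intros)
    have eq: "(\<lambda>x. c * (\<Prod>i<N. poly s (x i) * cnj (poly t (x i))) * G x) = (\<lambda>x. c * ((\<Prod>i<N. poly s (x i) * cnj (poly t (x i))) * G x))"
      by (simp only: mult.assoc)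
    show ?case
      unfolding eq integral_mult_right_zero weight(2)[OF cont] zero
      using weight(1)[OF cont] by simp
  next
    case (add \<Phi> \<Psi>)
    then show ?case by (simp add: distrib_right)
  qed
  define I where "I = (LINT x|?PM. (\<Prod>i<N. h (x i)) * G x)"
  define C where "C = (LINT x|?PM. cmod (G x))"
  have C: "C \<ge> 0" by (simp add: C_def)
  have sub: "x \<in> polydisk N" if "x \<in> space ?PM" for x
    using that by (force simp: space_PiM polydisk_def PiE_def Pi_def extensional_def)
  have "cmod I \<le> e" if e: "e > 0" for e
  proof -
    \<comment> \<open>The approximation error is multiplied by the L1 norm \<open>C\<close> of
      \<open>G\<close>; the \<open>+ 1\<close> covers C = 0.\<close>
    have e': "e / (C + 1) > 0" using e C by simp
    obtain \<Psi> where \<Psi>: "sym_alg N \<Psi>" "\<And>z. z \<in> polydisk N \<Longrightarrow> cmod ((\<Prod>i<N. h (z i)) - \<Psi> z) < e / (C + 1)"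
      using sym_alg_dense_prod[OF h e', of N] by blast
    have "I = (LINT x|?PM. (\<Prod>i<N. h (x i)) * G x) - (LINT x|?PM. \<Psi> x * G x)"
      using sym[OF \<Psi>(1)] by (simp add: I_def)
    also have "\<dots> = (LINT x|?PM. ((\<Prod>i<N. h (x i)) - \<Psi> x) * G x)"
      using sym[OF \<Psi>(1)] weight(1)[OF h] by (simp add: left_diff_distrib)
    finally have "cmod I \<le> (LINT x|?PM. cmod (((\<Prod>i<N. h (x i)) - \<Psi> x) * G x))"
      by (simp only: integral_norm_bound)
    also have "\<dots> \<le> (LINT x|?PM. e / (C + 1) * cmod (G x))"
    proof (rule integral_mono)
      show "integrable ?PM (\<lambda>x. cmod (((\<Prod>i<N. h (x i)) - \<Psi> x) * G x))"
        using sym[OF \<Psi>(1)] weight(1)[OF h] by (intro integrable_norm) (simp add: left_diff_distrib)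
      show "integrable ?PM (\<lambda>x. e / (C + 1) * cmod (G x))"
        using G_int by (intro integrable_mult_right integrable_norm)
      show "cmod (((\<Prod>i<N. h (x i)) - \<Psi> x) * G x) \<le> e / (C + 1) * cmod (G x)" if "x \<in> space ?PM" for x
        unfolding norm_mult using \<Psi>(2)[OF sub[OF that]] by (intro mult_right_mono) auto
    qed
    also have "\<dots> = e / (C + 1) * C" by (simp add: C_def)
    also have "\<dots> \<le> e" using e C by (simp add: field_simps)
    finally show ?thesis .
  qed
  then have "cmod I \<le> 0" by (rule field_le_epsilon) simp
  then have "I = 0" by simp
  then show ?thesis using weight(2)[OF h] by (simp add: I_def)
qed

text \<open>Lebesgue measurable functions are limits of continuous ones almost everywhere. Composing
  with \<open>clip\<close> supplies the uniform bound that dominated convergence requires.\<close>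

lemma continuous_approx_unimodular:
  assumes g: "g \<in> borel_measurable disk_measure"
  shows "\<exists>h :: nat \<Rightarrow> complex \<Rightarrow> complex. (\<forall>n. continuous_on UNIV (h n)) \<and> (\<forall>n z. cmod (h n z) \<le> 1) \<and>
    (AE z in disk_measure. (\<lambda>n. h n z) \<longlonglongrightarrow> cnj (sgn (g z)))"
proof -
  define f where "f z = indicator (ball 0 1) z *\<^sub>R cnj (sgn (g z))" for z
  have "(\<lambda>z. cnj (sgn (g z))) \<in> borel_measurable disk_measure" using g by measurable
  then have "(\<lambda>z. cnj (sgn (g z))) \<in> borel_measurable (lebesgue_on (ball 0 1))"
    by (simp add: disk_measure_def)
  then have "f \<in> borel_measurable lebesgue"
    unfolding f_def by (subst borel_measurable_restrict_space_iff[symmetric]) auto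
  then have "f measurable_on UNIV"
    by (rule lebesgue_measurable_imp_measurable_on) simp
  then obtain S k where S: "negligible S" and k: "\<And>n. continuous_on UNIV (k n)"
    "\<And>z. z \<notin> S \<Longrightarrow> (\<lambda>n. k n z) \<longlonglongrightarrow> f z"
    unfolding measurable_on_def by auto
  \<comment> \<open>The radial retraction onto the closed unit disk: it is continuous and fixes the
    limit \<open>f\<close>, whose values are 0 or unimodular.\<close>
  define clip where "clip w = w / of_real (max 1 (cmod w))" for w :: complex
  have clip_cont: "continuous_on UNIV clip"
    unfolding clip_def by (intro continuous_intros) (auto simp: max_def)
  have clip_le: "cmod (clip w) \<le> 1" for w
    by (simp add: clip_def norm_divide max_def)
  have "cmod (f z) \<le> 1" for z
    by (auto simp: f_def indicator_def norm_sgn)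
  then have clip_f: "clip (f z) = f z" for z
    by (simp add: clip_def max_absorb1)
  have "AE z in lebesgue. z \<notin> S"
    using S by (simp add: AE_not_in negligible_iff_null_sets)
  then have "AE z in lebesgue_on (ball 0 1). z \<notin> S"
    by (subst AE_restrict_space_iff) (auto elim: eventually_mono)
  then have "AE z in disk_measure. z \<notin> S"
    unfolding disk_measure_def by (subst AE_density) (auto elim: eventually_mono)
  moreover have "AE z in disk_measure. z \<in> ball 0 1"
    using AE_space[of disk_measure] by simp
  ultimately have lim: "AE z in disk_measure. (\<lambda>n. clip (k n z)) \<longlonglongrightarrow> cnj (sgn (g z))"
  proof eventually_elim
    case (elim z)
    have "(\<lambda>n. clip (k n z)) \<longlonglongrightarrow> clip (f z)"
      using clip_cont k(2)[OF elim(1)] by (auto intro: continuous_on_tendsto_compose)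
    then show ?case using elim(2) by (simp add: clip_f) (simp add: f_def)
  qed
  show ?thesis
    by (intro exI[of _ "\<lambda>n z. clip (k n z)"] conjI allI lim clip_le continuous_on_compose2[OF clip_cont k(1)]) simp
qed

text \<open>In the limit the weights turn g into |g|, and \<open>m'\<close> is the Gram matrix of
  the monomials for the measure |g| dA. A kernel vector is a nonzero polynomial p with |p|^2 |g| of
  integral 0, and p has only finitely many zeros.\<close>

theorem toeplitz_finite_rank_imp_zero:
  assumes g: "g \<in> L2_disk" and rank: "finite_rank_on_polys (toeplitz g)"
  shows "AE z in disk_measure. g z = 0"
proof -
  obtain N where N: "\<forall>s t. Determinant.det (mat N N (\<lambda>(i, j).
      LINT z|disk_measure. z ^ i * cnj (z ^ j) * (poly s z * cnj (poly t z) * g z))) = 0"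
    using finite_rank_imp_det_eq_0[OF g rank] by (rule exE)
  note [measurable] = L2_diskD(1)[OF g]
  obtain h where h: "\<And>n. continuous_on UNIV (h n)" "\<And>n z. cmod (h n z) \<le> 1"
    "AE z in disk_measure. (\<lambda>n. h n z) \<longlonglongrightarrow> cnj (sgn (g z))"
    using continuous_approx_unimodular[OF L2_diskD(1)[OF g]] by blast
  define m where "m n i j = (LINT z|disk_measure. z ^ i * cnj (z ^ j) * (h n z * g z))" for n i j
  define m' where "m' i j = (LINT z|disk_measure. z ^ i * cnj (z ^ j) * of_real (cmod (g z)))" for i j
  \<comment> \<open>At w = 0 this rests on the convention that \<open>sgn 0\<close> is 0.\<close>
  have sgn: "cnj (sgn w) * w = of_real (cmod w)" for w :: complex
    by (cases "w = 0") (simp_all add: sgn_div_norm scaleR_conv_of_real complex_norm_square[symmetric] field_simps power2_eq_square)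
  have h_meas [measurable]: "h n \<in> borel_measurable disk_measure" for n
    by (intro continuous_on_measurable_disk continuous_on_subset[OF h(1)]) simp
  have mono_meas [measurable]: "(\<lambda>z. z ^ i * cnj (z ^ j)) \<in> borel_measurable disk_measure" for i j
    by (intro continuous_on_measurable_disk continuous_intros)
  have bound: "AE z in disk_measure. norm (z ^ i * cnj (z ^ j) * (h n z * g z)) \<le> cmod (g z)" for n i j
  proof (rule AE_I2)
    fix z assume "z \<in> space disk_measure"
    then have z: "z \<in> ball 0 1" by simp
    have "norm (z ^ i * cnj (z ^ j) * (h n z * g z)) = (cmod z ^ i * cmod z ^ j) * (cmod (h n z) * cmod (g z))"
      by (simp add: norm_mult norm_power)
    also have "\<dots> \<le> 1 * (1 * cmod (g z))"
      using z by (intro mult_mono mult_le_one power_le_one h(2)) auto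
    finally show "norm (z ^ i * cnj (z ^ j) * (h n z * g z)) \<le> cmod (g z)" by simp
  qed
  have lim: "(\<lambda>n. m n i j) \<longlonglongrightarrow> m' i j" for i j
    unfolding m_def m'_def
  proof (rule integral_dominated_convergence[OF _ _ _ _ bound])
    show "AE z in disk_measure. (\<lambda>n. z ^ i * cnj (z ^ j) * (h n z * g z)) \<longlonglongrightarrow> z ^ i * cnj (z ^ j) * of_real (cmod (g z))"
      using h(3)
    proof eventually_elim
      case (elim z)
      have "(\<lambda>n. z ^ i * cnj (z ^ j) * (h n z * g z)) \<longlonglongrightarrow> z ^ i * cnj (z ^ j) * (cnj (sgn (g z)) * g z)"
        by (intro tendsto_intros elim)
      then show ?case by (simp only: sgn)
    qed
    show "integrable disk_measure (\<lambda>z. cmod (g z))" using integrable_L2_disk[OF g] by (rule integrable_norm)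
  qed measurable
  \<comment> \<open>By Leibniz's formula the determinant is a polynomial in the entries, hence
    continuous in them.\<close>
  have "(\<lambda>n. Determinant.det (mat N N (\<lambda>(i, j). m n i j))) \<longlonglongrightarrow> Determinant.det (mat N N (\<lambda>(i, j). m' i j))"
    unfolding det_leibniz by (intro tendsto_intros lim)
  moreover have "Determinant.det (mat N N (\<lambda>(i, j). m n i j)) = 0" for n
    unfolding m_def by (rule det_weight_eq_0[OF g N[rule_format]]) (rule continuous_on_subset[OF h(1)], simp)
  ultimately have "Determinant.det (mat N N (\<lambda>(i, j). m' i j)) = 0"
    by (simp add: LIMSEQ_const_iff)
  then obtain v where v: "\<exists>i<N. v i \<noteq> 0" "\<And>i. i < N \<Longrightarrow> (\<Sum>j<N. m' i j * v j) = 0"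
    unfolding det_eq_0_iff_kernel by blast
  \<comment> \<open>The conjugates are forced by z^i conj(z^j) in \<open>m'\<close>: they make the
    quadratic form of \<open>v\<close> the integral of |p|^2 |g|.\<close>
  define p where "p = (\<Sum>j<N. monom (cnj (v j)) j)"
  have poly_p: "poly p z = (\<Sum>j<N. cnj (v j) * z ^ j)" for z by (simp add: p_def poly_sum poly_monom)
  have p0: "p \<noteq> 0"
  proof
    assume "p = 0"
    obtain i where i: "i < N" "v i \<noteq> 0" using v(1) by blast
    have "coeff p i = cnj (v i)" using i by (simp add: p_def coeff_sum)
    with i \<open>p = 0\<close> show False by simp
  qed
  \<comment> \<open>The bounded weight conj(sgn g) already produces |g|, so the general
    integrability lemma applies with constant 1.\<close>
  have int: "integrable disk_measure (\<lambda>z. z ^ i * cnj (z ^ j) * of_real (cmod (g z)))" for i j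
    using integrable_monomials_weight[OF g, of "\<lambda>z. cnj (sgn (g z))" 1 i j]
    by (simp add: sgn norm_sgn)
  have "complex_of_real (LINT z|disk_measure. (cmod (poly p z))\<^sup>2 * cmod (g z)) =
      (LINT z|disk_measure. of_real ((cmod (poly p z))\<^sup>2 * cmod (g z)))"
    by (rule integral_complex_of_real[symmetric])
  also have "\<dots> = (LINT z|disk_measure. (\<Sum>i<N. \<Sum>j<N. cnj (v i) * (z ^ i * cnj (z ^ j) * of_real (cmod (g z))) * v j))"
  proof (intro Bochner_Integration.integral_cong refl)
    fix z
    have "complex_of_real ((cmod (poly p z))\<^sup>2 * cmod (g z)) = poly p z * cnj (poly p z) * of_real (cmod (g z))"
      by (simp only: of_real_mult complex_norm_square)
    also have "poly p z * cnj (poly p z) = (\<Sum>i<N. \<Sum>j<N. (cnj (v i) * z ^ i) * (v j * cnj (z ^ j)))"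
      unfolding poly_p cnj_sum sum_product by simp
    also have "\<dots> * of_real (cmod (g z)) =
        (\<Sum>i<N. \<Sum>j<N. cnj (v i) * (z ^ i * cnj (z ^ j) * of_real (cmod (g z))) * v j)"
      by (simp only: sum_distrib_right, intro sum.cong refl) (simp add: mult_ac)
    finally show "complex_of_real ((cmod (poly p z))\<^sup>2 * cmod (g z)) =
        (\<Sum>i<N. \<Sum>j<N. cnj (v i) * (z ^ i * cnj (z ^ j) * of_real (cmod (g z))) * v j)" .
  qed
  also have "\<dots> = (\<Sum>i<N. \<Sum>j<N. cnj (v i) * m' i j * v j)"
    unfolding m'_def
    by (subst Bochner_Integration.integral_sum,
        intro Bochner_Integration.integrable_sum integrable_mult_left integrable_mult_right int,
        intro sum.cong refl, subst Bochner_Integration.integral_sum,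
        intro integrable_mult_left integrable_mult_right int, simp only: integral_mult_right_zero integral_mult_left_zero)
  also have "\<dots> = (\<Sum>i<N. cnj (v i) * (\<Sum>j<N. m' i j * v j))"
    by (simp only: sum_distrib_left mult.assoc)
  also have "\<dots> = 0" using v(2) by simp
  finally have zero: "(LINT z|disk_measure. (cmod (poly p z))\<^sup>2 * cmod (g z)) = 0"
    by (simp only: of_real_eq_0_iff)
  have "compact (poly p ` cball 0 1)" by (intro compact_continuous_image continuous_intros) simp
  then obtain C where C: "\<And>z. z \<in> cball 0 1 \<Longrightarrow> cmod (poly p z) \<le> C"
    by (meson bounded_iff compact_imp_bounded imageI)
  have p_meas [measurable]: "poly p \<in> borel_measurable disk_measure"
    by (intro continuous_on_measurable_disk continuous_intros)
  have "integrable disk_measure (\<lambda>z. (cmod (poly p z))\<^sup>2 * cmod (g z))"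
  proof (rule Bochner_Integration.integrable_bound)
    show "integrable disk_measure (\<lambda>z. C\<^sup>2 * cmod (g z))" using integrable_L2_disk[OF g] by auto
    show "AE z in disk_measure. norm ((cmod (poly p z))\<^sup>2 * cmod (g z)) \<le> norm (C\<^sup>2 * cmod (g z))"
      using C by (auto intro!: AE_I2 mult_right_mono power_mono)
  qed measurable
  then have "AE z in disk_measure. (cmod (poly p z))\<^sup>2 * cmod (g z) = 0"
    using zero by (subst (asm) integral_nonneg_eq_0_iff_AE) auto
  moreover have "AE z in disk_measure. poly p z \<noteq> 0"
  proof -
    have "negligible {z. poly p z = 0}" by (intro negligible_finite poly_roots_finite p0)
    then have "AE z in lebesgue. z \<notin> {z. poly p z = 0}"
      by (intro AE_not_in) (simp only: negligible_iff_null_sets)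
    then have "AE z in lebesgue_on (ball 0 1). poly p z \<noteq> 0"
      by (subst AE_restrict_space_iff) (auto elim: eventually_mono)
    then show ?thesis
      unfolding disk_measure_def by (subst AE_density) (auto elim: eventually_mono)
  qed
  ultimately show ?thesis by eventually_elim simp
qed

theorem theorem2p1:
  fixes M :: int and N :: nat and f g :: "complex \<Rightarrow> complex"
  assumes "f \<in> L2_disk"
    and "\<And>m::int. m > M \<Longrightarrow> AE r in lebesgue_on {0..<1}. angular_coeff f m r = 0"
    and "N > 0"
    and "\<And>k::nat. k \<ge> N \<Longrightarrow>
           (LINT r|lebesgue_on {0..<1}. angular_coeff f M r * of_real (r ^ k)) \<noteq> 0"
    and "g \<in> L2_disk"
    and "finite_rank_on_polys (toeplitz g \<circ> toeplitz f)"
  shows "AE z in disk_measure. g z = 0"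
proof (rule toeplitz_finite_rank_imp_zero[OF assms(5)])
  show "finite_rank_on_polys (toeplitz g)"
    by (rule finite_dimensional_toeplitz[where M = M and N = N, OF assms(1,2,4-6)])
qed

end
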